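(* Let $1<n<\infty$ and let $M$ be a $\mathcal{W}_n^+$-module which, by restriction, is a free $U(\mathfrak{h}_n)$-module of rank $1$. Then $M\cong\Omega(\Lambda_n,a,S)$ as $\mathcal{W}_n^+$-modules for some $\Lambda_n=(\lambda_1,\dots,\lambda_n)\in(\mathbb{C}^* )^n$, some $a\in\mathbb{C}$, and some subset $S\subset\{1,2,\dots,n\}$ (possibly empty, possibly everything).
   Context: $\mathbb{Z}_+$ is the set of non-negative integers, $\mathbb{C}^*=\mathbb{C}\setminus\{0\}$. $\mathcal{W}_n^+=\mathrm{Der}\,\mathbb{C}[t_1,\dots,t_n]$. Put $\partial_i=t_i\frac{\partial}{\partial t_i}$, $t^k=t_1^{k_1}\cdots t_n^{k_n}$, and $$\mathbb{Z}^n_{+,i}=\{(k_1,\dots,k_n)\in\mathbb{Z}^n: k_i\ge -1,\ k_j\in\mathbb{Z}_+\text{ for all }j\ne i\}.$$ Then $\mathcal{W}_n^+$ has basis $\{t^k\partial_i: 1\le i\le n,\ k\in\mathbb{Z}^n_{+,i}\}$ with bracket $[t^r\partial_i,t^s\partial_j]=s_it^{r+s}\partial_j-r_jt^{r+s}\partial_i$. Its Cartan subalgebra is $\mathfrak{h}_n=\bigoplus_{i=1}^n\mathbb{C}\partial_i$, so $U(\mathfrak{h}_n)=\mathbb{C}[\partial_1,\dots,\partial_n]$. Definition of $\Omega(\Lambda_n,a,S)$: let $\Lambda_n=(\lambda_1,\dots,\lambda_n)\in(\mathbb{C}^* )^n$, $a\in\mathbb{C}$, $S\subset\{1,\dots,n\}$,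 and $\Lambda_n^k=\lambda_1^{k_1}\cdots\lambda_n^{k_n}$. For $1\le i\le n$ and $k\in\mathbb{Z}^n_{+,i}$ put $$\phi_{S,a}(k,i)=(x_i-k_i(a+1))\prod_{q\in S}\prod_{p=0}^{k_q-1}(x_q+a-p)\quad\text{if }k_i\ne -1\text{ or }i\notin S,$$ $$\phi_{S,a}(k,i)=\prod_{q\in S\setminus\{i\}}\prod_{p=0}^{k_q-1}(x_q+a-p)\quad\text{if }k_i=-1\text{ and }i\in S,$$ with the convention $\prod_{p=0}^{-1}g(p)=1$. Then $\Omega(\Lambda_n,a,S)$ is the $\mathcal{W}_n^+$-module with underlying space $\mathbb{C}[x_1,\dots,x_n]$ and action $$t^k\partial_i\cdot f(x_1,\dots,x_n)=\Lambda_n^k\,f(x_1-k_1,\dots,x_n-k_n)\,\phi_{S,a}(k,i),\qquad 1\le i\le n,\ k\in\mathbb{Z}^n_{+,i}.$$ *)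

theory Defs
  imports Complex_Main "HOL-Library.Poly_Mapping" "HOL-Library.Cardinality"
begin

section \<open>Polynomials in finitely many variables\<close>

text \<open>
  The index set \<open>{1,\<dots>,n}\<close> is rendered by a finite type \<open>'n\<close> with \<open>CARD('n) = n\<close>.  The polynomial
  ring over the complex numbers in variables indexed by \<open>'n\<close> is the monoid algebra of the
  exponents \<open>'n \<Rightarrow>\<^sub>0 nat\<close>.
\<close>

type_synonym 'n mpol = "('n \<Rightarrow>\<^sub>0 nat) \<Rightarrow>\<^sub>0 complex"

definition Const :: "complex \<Rightarrow> 'n mpol" where
  "Const c = Poly_Mapping.single 0 c"

definition Var :: "'n \<Rightarrow> 'n mpol" where
  "Var i = Poly_Mapping.single (Poly_Mapping.single i 1) 1"

definition pscale :: "complex \<Rightarrow> 'n mpol \<Rightarrow> 'n mpol" where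
  "pscale c f = Const c * f"

definition monomial :: "('n::finite \<Rightarrow> nat) \<Rightarrow> 'n mpol" where
  "monomial m = Poly_Mapping.single (Abs_poly_mapping m) 1"

definition psubst :: "('n::finite \<Rightarrow> 'n mpol) \<Rightarrow> 'n mpol \<Rightarrow> 'n mpol" where
  "psubst g f = (\<Sum>\<alpha>\<in>Poly_Mapping.keys f. Const (Poly_Mapping.lookup f \<alpha>) * (\<Prod>i\<in>UNIV. g i ^ Poly_Mapping.lookup \<alpha> i))"

text \<open>If \<open>\<alpha>\<close> does not involve \<open>i\<close>, the truncated exponent below is harmless: the coefficient is 0.\<close>

definition pderiv_at :: "'n \<Rightarrow> 'n mpol \<Rightarrow> 'n mpol" where
  "pderiv_at i f =
     (\<Sum>\<alpha>\<in>Poly_Mapping.keys f. Poly_Mapping.single (\<alpha> - Poly_Mapping.single i 1)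
                     (of_nat (Poly_Mapping.lookup \<alpha> i) * Poly_Mapping.lookup f \<alpha>))"

section \<open>The Lie algebra of derivations and its modules\<close>

definition Wn :: "('n mpol \<Rightarrow> 'n mpol) set" where
  "Wn = {D. Vector_Spaces.linear pscale pscale D \<and> (\<forall>f g. D (f * g) = D f * g + f * D g)}"

definition lie_bracket :: "('n mpol \<Rightarrow> 'n mpol) \<Rightarrow> ('n mpol \<Rightarrow> 'n mpol) \<Rightarrow> 'n mpol \<Rightarrow> 'n mpol" where
  "lie_bracket D E = (\<lambda>f. D (E f) - E (D f))"

definition Zplus :: "'n \<Rightarrow> ('n \<Rightarrow> int) set" where
  "Zplus i = {k. k i \<ge> -1 \<and> (\<forall>j. j \<noteq> i \<longrightarrow> k j \<ge> 0)}"

text \<open>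
  For \<open>k \<in> Zplus i\<close> this is \<open>t\<^sup>k \<partial>\<^sub>i = t\<^sup>k t\<^sub>i (d/dt\<^sub>i)\<close>: the two powers of \<open>t\<close> are merged so that all
  exponents are natural numbers.
\<close>

definition Wbasis :: "('n::finite \<Rightarrow> int) \<Rightarrow> 'n \<Rightarrow> 'n mpol \<Rightarrow> 'n mpol" where
  "Wbasis k i = (\<lambda>f. monomial (\<lambda>j. nat (k j + of_bool (j = i))) * pderiv_at i f)"

abbreviation euler :: "'n::finite \<Rightarrow> 'n mpol \<Rightarrow> 'n mpol" where
  "euler i \<equiv> Wbasis (\<lambda>_. 0) i"

locale Wn_module = vector_space scale
  for scale :: "complex \<Rightarrow> 'm::ab_group_add \<Rightarrow> 'm" +
  fixes act :: "('n::finite mpol \<Rightarrow> 'n mpol) \<Rightarrow> 'm \<Rightarrow> 'm"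
  assumes act_add_right: "D \<in> Wn \<Longrightarrow> act D (u + v) = act D u + act D v"
    and act_scale_right: "D \<in> Wn \<Longrightarrow> act D (scale c v) = scale c (act D v)"
    and act_add_left: "D \<in> Wn \<Longrightarrow> E \<in> Wn \<Longrightarrow> act (\<lambda>f. D f + E f) v = act D v + act E v"
    and act_scale_left: "D \<in> Wn \<Longrightarrow> act (\<lambda>f. pscale c (D f)) v = scale c (act D v)"
    and act_bracket:
      "D \<in> Wn \<Longrightarrow> E \<in> Wn \<Longrightarrow> act (lie_bracket D E) v = act D (act E v) - act E (act D v)"

definition Wn_module_isomorphic ::
  "(complex \<Rightarrow> 'a::ab_group_add \<Rightarrow> 'a) \<Rightarrow> (('n::finite mpol \<Rightarrow> 'n mpol) \<Rightarrow> 'a \<Rightarrow> 'a) \<Rightarrow>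
   (complex \<Rightarrow> 'b::ab_group_add \<Rightarrow> 'b) \<Rightarrow> (('n mpol \<Rightarrow> 'n mpol) \<Rightarrow> 'b \<Rightarrow> 'b) \<Rightarrow> bool" where
  "Wn_module_isomorphic scale1 act1 scale2 act2 \<longleftrightarrow>
     Wn_module scale1 act1 \<and> Wn_module scale2 act2 \<and>
     (\<exists>\<phi>. Vector_Spaces.linear scale1 scale2 \<phi> \<and> bij \<phi> \<and>
          (\<forall>D\<in>Wn. \<forall>v. \<phi> (act1 D v) = act2 D (\<phi> v)))"

section \<open>Restriction to the Cartan subalgebra\<close>

text \<open>
  The Cartan subalgebra is abelian with basis \<open>\<partial>\<^sub>i\<close> (\<open>euler i\<close>), so its enveloping algebra is the
  polynomial ring in the \<open>\<partial>\<^sub>i\<close>; here \<open>Var i\<close> stands for \<open>\<partial>\<^sub>i\<close>.  A monomial acts by applying the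
  powers of the commuting operators \<open>act (euler i)\<close> one after the other.
\<close>

definition monomial_op ::
  "(('n::finite mpol \<Rightarrow> 'n mpol) \<Rightarrow> 'm \<Rightarrow> 'm) \<Rightarrow> ('n \<Rightarrow>\<^sub>0 nat) \<Rightarrow> 'n set \<Rightarrow> 'm \<Rightarrow> 'm" where
  "monomial_op act \<alpha> A v =
     Finite_Set.fold (\<lambda>i u. (act (euler i) ^^ Poly_Mapping.lookup \<alpha> i) u) v A"

definition Uh_scale ::
  "(complex \<Rightarrow> 'm::ab_group_add \<Rightarrow> 'm) \<Rightarrow> (('n::finite mpol \<Rightarrow> 'n mpol) \<Rightarrow> 'm \<Rightarrow> 'm) \<Rightarrow>
   'n mpol \<Rightarrow> 'm \<Rightarrow> 'm" where
  "Uh_scale scale act p v =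
     (\<Sum>\<alpha>\<in>Poly_Mapping.keys p. scale (Poly_Mapping.lookup p \<alpha>) (monomial_op act \<alpha> UNIV v))"

definition free_module_of_rank :: "('r::comm_ring_1 \<Rightarrow> 'm::ab_group_add \<Rightarrow> 'm) \<Rightarrow> nat \<Rightarrow> bool" where
  "free_module_of_rank smult r \<longleftrightarrow>
     module smult \<and>
     (\<exists>B. finite B \<and> card B = r \<and> \<not> module.dependent smult B \<and> module.span smult B = UNIV)"

section \<open>The modules \<open>\<Omega>(\<Lambda>, a, S)\<close>\<close>

definition phi :: "'n::finite set \<Rightarrow> complex \<Rightarrow> ('n \<Rightarrow> int) \<Rightarrow> 'n \<Rightarrow> 'n mpol" where
  "phi S a k i =
     (if k i \<noteq> -1 \<or> i \<notin> S
      then (Var i - Const (of_int (k i) * (a + 1))) *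
           (\<Prod>q\<in>S. \<Prod>p<nat (k q). Var q + Const (a - of_nat p))
      else (\<Prod>q\<in>S - {i}. \<Prod>p<nat (k q). Var q + Const (a - of_nat p)))"

definition Omega_basis_act ::
  "('n::finite \<Rightarrow> complex) \<Rightarrow> complex \<Rightarrow> 'n set \<Rightarrow> ('n \<Rightarrow> int) \<Rightarrow> 'n \<Rightarrow> 'n mpol \<Rightarrow> 'n mpol" where
  "Omega_basis_act \<Lambda> a S k i f =
     Const (\<Prod>j\<in>UNIV. \<Lambda> j powi k j) * psubst (\<lambda>j. Var j - Const (of_int (k j))) f * phi S a k i"

text \<open>
  Linear extension from the basis: a derivation \<open>D\<close> equals \<open>\<Sum>\<^sub>i D(t\<^sub>i) (d/dt\<^sub>i)\<close>, so its coefficient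
  at \<open>t\<^sup>k \<partial>\<^sub>i\<close> is the coefficient of \<open>D(t\<^sub>i)\<close> at the monomial with exponent \<open>k + e\<^sub>i\<close>.
\<close>

definition Omega_act ::
  "('n::finite \<Rightarrow> complex) \<Rightarrow> complex \<Rightarrow> 'n set \<Rightarrow> ('n mpol \<Rightarrow> 'n mpol) \<Rightarrow> 'n mpol \<Rightarrow> 'n mpol" where
  "Omega_act \<Lambda> a S D f =
     (\<Sum>i\<in>UNIV. \<Sum>m\<in>Poly_Mapping.keys (D (Var i)).
        pscale (Poly_Mapping.lookup (D (Var i)) m)
          (Omega_basis_act \<Lambda> a S (\<lambda>j. int (Poly_Mapping.lookup m j) - of_bool (j = i)) i f))"

section \<open>The definitions agree with their specifications\<close>

text \<open>
  \<open>Omega_act\<close> has the prescribed values on the basis (\<open>Omega_act_Wbasis\<close>), and \<open>Uh_scale\<close> is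
  the module structure over the enveloping algebra in which \<open>\<partial>\<^sub>i\<close> acts by \<open>act (euler i)\<close>
  (\<open>module_Uh_scale\<close>, \<open>Uh_scale_Const\<close>, \<open>Uh_scale_Var\<close>).
\<close>

lemma mpol_induct [case_names add single]:
  fixes f :: "'n mpol"
  assumes "\<And>f g. P f \<Longrightarrow> P g \<Longrightarrow> P (f + g)" and "\<And>\<alpha> c. P (Poly_Mapping.single \<alpha> c)"
  shows "P f"
proof (induction f rule: Poly_Mapping.update_induct)
  case const
  then show ?case using assms(2)[of 0 0] by simp
next
  case (update f a b)
  have "Poly_Mapping.update a b f = f + Poly_Mapping.single a b"
    using update(1)
    by (intro poly_mapping_eqI) (auto simp: lookup_update lookup_add lookup_single in_keys_iff when_def)
  then show ?case using assms update by simp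
qed

lemma vector_space_pscale: "vector_space pscale"
  by unfold_locales
    (auto simp: pscale_def Const_def algebra_simps single_add mult_single simp flip: mult.assoc)

lemma pderiv_at_add: "pderiv_at i (f + g) = pderiv_at i f + pderiv_at i g"
  unfolding pderiv_at_def
  by (rule setsum_keys_plus_distrib) (auto simp: algebra_simps single_add)

lemma pderiv_at_single:
  "pderiv_at i (Poly_Mapping.single \<alpha> c) =
     Poly_Mapping.single (\<alpha> - Poly_Mapping.single i 1) (of_nat (Poly_Mapping.lookup \<alpha> i) * c)"
  by (cases "c = 0") (auto simp: pderiv_at_def)

lemma shift_exponent:
  fixes \<alpha> \<beta> :: "'n \<Rightarrow>\<^sub>0 nat"
  assumes "Poly_Mapping.lookup \<alpha> i \<noteq> 0"
  shows "\<alpha> - Poly_Mapping.single i 1 + \<beta> = \<alpha> + \<beta> - Poly_Mapping.single i 1"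
  using assms
  by (intro poly_mapping_eqI) (auto simp: lookup_add lookup_minus lookup_single when_def)

lemma pderiv_at_mult: "pderiv_at i (f * g) = pderiv_at i f * g + f * pderiv_at i g"
proof (induction f rule: mpol_induct)
  case (add f f')
  then show ?case by (simp add: pderiv_at_add algebra_simps)
next
  case (single \<alpha> c)
  show ?case
  proof (induction g rule: mpol_induct)
    case (add g g')
    then show ?case by (simp add: pderiv_at_add algebra_simps)
  next
    case (single \<beta> d)
    have "Poly_Mapping.lookup \<alpha> i = 0 \<or>
        \<alpha> - Poly_Mapping.single i 1 + \<beta> = \<alpha> + \<beta> - Poly_Mapping.single i 1"
      using shift_exponent[of \<alpha> i \<beta>] by auto
    moreover have "Poly_Mapping.lookup \<beta> i = 0 \<or>
        \<alpha> + (\<beta> - Poly_Mapping.single i 1) = \<alpha> + \<beta> - Poly_Mapping.single i 1"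
      using shift_exponent[of \<beta> i \<alpha>] by (auto simp: add.commute)
    ultimately show ?case
      by (auto simp: pderiv_at_single mult_single lookup_add algebra_simps single_add
               simp flip: single_add)
  qed
qed

lemma Wbasis_in_Wn: "Wbasis k i \<in> Wn"
proof -
  have "pderiv_at i (Const c) = 0" for c
    by (simp add: Const_def pderiv_at_single)
  then show ?thesis
    by (auto simp: Wn_def Wbasis_def Vector_Spaces.linear_iff vector_space_pscale
        pderiv_at_add pderiv_at_mult pscale_def algebra_simps)
qed

lemma Wbasis_Var:
  "Wbasis k i (Var j) = (if j = i then monomial (\<lambda>j. nat (k j + of_bool (j = i))) else 0)"
  by (auto simp: Wbasis_def Var_def pderiv_at_single lookup_single)

lemma Omega_act_Wbasis:
  assumes "k \<in> Zplus i"
  shows "Omega_act \<Lambda> a S (Wbasis k i) f = Omega_basis_act \<Lambda> a S k i f"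
proof -
  have "k j + of_bool (j = i) \<ge> 0" for j
    using assms by (cases "j = i") (auto simp: Zplus_def)
  then have *: "(\<lambda>j. int (nat (k j + of_bool (j = i))) - of_bool (j = i)) = k"
    by (simp add: fun_eq_iff)
  have "Omega_act \<Lambda> a S (Wbasis k i) f =
      (\<Sum>j\<in>UNIV. if j = i then Omega_basis_act \<Lambda> a S k i f else 0)"
    unfolding Omega_act_def
    by (intro sum.cong) (auto simp: Wbasis_Var monomial_def * pscale_def Const_def simp del: int_nat_eq)
  then show ?thesis by simp
qed

lemma lookup_euler:
  "Poly_Mapping.lookup (euler i f) \<alpha> = of_nat (Poly_Mapping.lookup \<alpha> i) * Poly_Mapping.lookup f \<alpha>"
proof (induction f rule: mpol_induct)
  case (add f g)
  have "euler i (f + g) = euler i f + euler i g"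
    by (simp add: Wbasis_def pderiv_at_add algebra_simps)
  then show ?case using add by (simp add: lookup_add algebra_simps)
next
  case (single \<beta> c)
  have "Abs_poly_mapping (\<lambda>j. of_bool (j = i)) = Poly_Mapping.single i (1::nat)"
    by (intro poly_mapping_eqI) (auto simp: lookup_single when_def)
  moreover have "Poly_Mapping.lookup \<beta> i \<noteq> 0 \<Longrightarrow>
      Poly_Mapping.single i 1 + (\<beta> - Poly_Mapping.single i 1) = \<beta>"
    using shift_exponent[of \<beta> i "Poly_Mapping.single i 1"] by (simp add: add.commute)
  ultimately have "euler i (Poly_Mapping.single \<beta> c) =
      Poly_Mapping.single \<beta> (of_nat (Poly_Mapping.lookup \<beta> i) * c)"
    by (cases "Poly_Mapping.lookup \<beta> i = 0")
      (auto simp: Wbasis_def monomial_def pderiv_at_single mult_single nat_of_bool)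
  then show ?case by (auto simp: lookup_single when_def)
qed

context Wn_module begin

lemma act_euler_commute: "act (euler i) (act (euler j) v) = act (euler j) (act (euler i) v)"
proof -
  have "lie_bracket (euler i) (euler j) = (\<lambda>f. pscale 0 (euler i f))"
    by (intro ext poly_mapping_eqI)
      (simp add: lie_bracket_def lookup_minus lookup_euler pscale_def Const_def)
  then show ?thesis
    using act_bracket[OF Wbasis_in_Wn Wbasis_in_Wn, of "\<lambda>_. 0" i "\<lambda>_. 0" j v]
      act_scale_left[OF Wbasis_in_Wn, of 0 "\<lambda>_. 0" i v] by simp
qed

lemma funpow_euler_commute:
  "(act (euler i) ^^ k) ((act (euler j) ^^ l) v) = (act (euler j) ^^ l) ((act (euler i) ^^ k) v)"
proof -
  have 1: "act (euler i) ((act (euler j) ^^ l) v) = (act (euler j) ^^ l) (act (euler i) v)" for v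
    by (induction l) (simp, simp add: act_euler_commute[of i])
  show ?thesis by (induction k) (simp_all add: 1)
qed

lemma Uh_scale_single:
  "Uh_scale scale act (Poly_Mapping.single \<alpha> c) v =
   scale c (monomial_op act \<alpha> UNIV v)"
  by (cases "c = 0") (auto simp: Uh_scale_def)

lemma Uh_scale_add_left: "Uh_scale scale act (p + q) v = Uh_scale scale act p v + Uh_scale scale act q v"
  unfolding Uh_scale_def
  by (rule setsum_keys_plus_distrib) (auto simp: scale_left_distrib)

lemma comp_fun_commute_euler: "comp_fun_commute (\<lambda>i u. (act (euler i) ^^ Poly_Mapping.lookup \<alpha> i) u)"
  by unfold_locales (auto simp: fun_eq_iff funpow_euler_commute)

lemma monomial_op_insert:
  "finite A \<Longrightarrow> i \<notin> A \<Longrightarrow> monomial_op act \<alpha> (insert i A) v = (act (euler i) ^^ Poly_Mapping.lookup \<alpha> i) (monomial_op act \<alpha> A v)"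
proof -
  assume "finite A" "i \<notin> A"
  interpret comp_fun_commute "\<lambda>i u. (act (euler i) ^^ Poly_Mapping.lookup \<alpha> i) u"
    by (rule comp_fun_commute_euler)
  show ?thesis using \<open>finite A\<close> \<open>i \<notin> A\<close> by (simp add: monomial_op_def)
qed

lemma monomial_op_empty: "monomial_op act \<alpha> {} v = v"
  by (simp add: monomial_op_def)

lemma funpow_linear:
  "(act (euler i) ^^ k) (scale c u + scale d v) = scale c ((act (euler i) ^^ k) u) + scale d ((act (euler i) ^^ k) v)"
  by (induction k) (simp_all add: act_add_right act_scale_right Wbasis_in_Wn)

lemma monomial_op_linear: "finite A \<Longrightarrow> monomial_op act \<alpha> A (scale c u + scale d v) = scale c (monomial_op act \<alpha> A u) + scale d (monomial_op act \<alpha> A v)"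
  by (induction A rule: finite_induct) (simp_all add: monomial_op_empty monomial_op_insert funpow_linear)

lemma monomial_op_funpow: "finite A \<Longrightarrow> monomial_op act \<alpha> A ((act (euler i) ^^ k) v) = (act (euler i) ^^ k) (monomial_op act \<alpha> A v)"
  by (induction A rule: finite_induct) (simp_all add: monomial_op_empty monomial_op_insert funpow_euler_commute)

lemma monomial_op_add: "finite A \<Longrightarrow> monomial_op act (\<alpha> + \<beta>) A v = monomial_op act \<alpha> A (monomial_op act \<beta> A v)"
  by (induction A rule: finite_induct)
    (simp_all add: monomial_op_empty monomial_op_insert lookup_add funpow_add monomial_op_funpow,
      metis funpow_euler_commute)

lemma monomial_op_0: "finite A \<Longrightarrow> monomial_op act 0 A v = v"
  by (induction A rule: finite_induct) (simp_all add: monomial_op_empty monomial_op_insert)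

lemma monomial_op_Var: "finite A \<Longrightarrow> monomial_op act (Poly_Mapping.single i 1) A v = (if i \<in> A then act (euler i) v else v)"
  by (induction A rule: finite_induct) (auto simp: monomial_op_empty monomial_op_insert lookup_single when_def)

lemma Uh_scale_add_right: "Uh_scale scale act p (u + v) = Uh_scale scale act p u + Uh_scale scale act p v"
  using monomial_op_linear[of UNIV _ 1 u 1 v]
  by (simp add: Uh_scale_def scale_right_distrib sum.distrib)

lemma Uh_scale_scale: "Uh_scale scale act p (scale c v) = scale c (Uh_scale scale act p v)"
  using monomial_op_linear[of UNIV _ c v 0 v]
  by (simp add: Uh_scale_def scale_sum_right mult.commute)

lemma module_Uh_scale: "module (Uh_scale scale act)"
proof
  fix p q :: "'n mpol" and u v
  show "Uh_scale scale act p (u + v) = Uh_scale scale act p u + Uh_scale scale act p v"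
    by (rule Uh_scale_add_right)
  show "Uh_scale scale act (p + q) v = Uh_scale scale act p v + Uh_scale scale act q v"
    by (rule Uh_scale_add_left)
  show "Uh_scale scale act 1 v = v"
    by (simp add: Uh_scale_single monomial_op_0 flip: single_one)
  show "Uh_scale scale act p (Uh_scale scale act q v) = Uh_scale scale act (p * q) v"
  proof (induction p rule: mpol_induct)
    case (add f g)
    then show ?case by (simp add: Uh_scale_add_left algebra_simps)
  next
    case (single \<alpha> c)
    show ?case
    proof (induction q rule: mpol_induct)
      case (add f g)
      then show ?case by (simp add: Uh_scale_add_left Uh_scale_add_right algebra_simps)
    next
      case (single \<beta> d)
      then show ?case
        by (simp add: mult_single Uh_scale_single[of "\<alpha> + \<beta>"] Uh_scale_single[of \<beta>] Uh_scale_scale)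
          (simp add: Uh_scale_single monomial_op_add mult.commute)
    qed
  qed
qed

lemma Uh_scale_Const: "Uh_scale scale act (Const c) v = scale c v"
  by (simp add: Const_def Uh_scale_single monomial_op_0)

lemma Uh_scale_Var: "Uh_scale scale act (Var i) v = act (euler i) v"
  using monomial_op_Var[of UNIV i v] by (simp add: Var_def Uh_scale_single)

end

end

theory Submission
  imports Defs "HOL-Computational_Algebra.Polynomial" "HOL-Analysis.Gamma_Function"
begin

text \<open>
  Let \<open>v\<close> generate the module over \<open>U(h)\<close>, identified with the polynomials in \<open>x\<^sub>1, \<dots>, x\<^sub>n\<close>.  Since
  \<open>t\<^sup>k \<partial>\<^sub>i\<close> has weight \<open>k\<close>, it acts by \<open>p v \<mapsto> p(x - k) F\<^sub>k\<^sub>,\<^sub>i v\<close>, where \<open>F\<^sub>k\<^sub>,\<^sub>i v = t\<^sup>k \<partial>\<^sub>i v\<close>.  So the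
  module is the same thing as the family \<open>F\<close>, subject to the difference equations that express the
  brackets (\<open>shift_system\<close>).  It has to be shown that \<open>F\<close> is the family of some
  \<open>\<Omega>(\<Lambda>, a, S)\<close>; the \<open>\<mu>\<close> below becomes \<open>\<Lambda>\<close>.

  Bracketing \<open>\<partial>/\<partial>t\<^sub>i\<close> with \<open>t\<^sub>i \<partial>\<^sub>i\<close>, and with \<open>t\<^sub>i \<partial>\<^sub>j\<close> for some \<open>j \<noteq> i\<close>, shows that the polynomial
  describing \<open>\<partial>/\<partial>t\<^sub>i\<close> divides (after a shift) both \<open>x\<^sub>i\<^sup>2 - x\<^sub>i + c\<close> and \<open>x\<^sub>i x\<^sub>j + c'\<close>, where \<open>c\<close> and \<open>c'\<close>
  do not involve \<open>x\<^sub>i\<close>.  This leaves two possibilities, \<open>1/\<mu>\<^sub>i\<close> and \<open>(x\<^sub>i + b)/\<mu>\<^sub>i\<close>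
  (\<open>factor_dichotomy\<close>), and \<open>S\<close> is the set of the indices \<open>i\<close> of the first kind.  The second
  index is where \<open>n > 1\<close> first enters.  The relations among the \<open>\<partial>/\<partial>t\<^sub>i\<close> and \<open>t\<^sub>j \<partial>\<^sub>j\<close> force \<open>b\<close> to be a
  constant (\<open>b_const\<close>); then each \<open>t\<^sub>i \<partial>\<^sub>j\<close> is known up to constants, and the relations
  that involve the \<open>t\<^sub>i \<partial>/\<partial>t\<^sub>j\<close> express all of these through a single number \<open>a\<close> (\<open>generators_determined\<close>).

  The elements \<open>\<partial>/\<partial>t\<^sub>i\<close>, \<open>\<partial>\<^sub>i\<close>, \<open>t\<^sub>i \<partial>\<^sub>j\<close> generate the Lie algebra.  To carry the formula along
  brackets, rescale by \<open>\<theta>(x) = \<Prod>\<^sub>j \<mu>\<^sub>j\<^bsup>x\<^sub>j\<^esup> \<Prod>\<^sub>q \<Gamma>(x\<^sub>q + a + 1)\<close> with \<open>q\<close> ranging over \<open>S\<close>: this turns the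
  expected value of \<open>F\<^sub>k\<^sub>,\<^sub>i\<close> into \<open>x\<^sub>i - k\<^sub>i (a + 1)\<close>, in which \<open>\<mu>\<close> and \<open>S\<close> have disappeared and
  compatibility with brackets is a short computation (\<open>untwisted_bracket\<close>).  That
  \<open>\<Omega>(\<Lambda>, a, S)\<close> is a module then follows by transport of structure along \<open>p \<mapsto> p v\<close>.
\<close>

section \<open>Polynomial functions\<close>

text \<open>
  Polynomials are handled through the functions on \<open>\<complex>\<^sup>n\<close> that they define: the arguments below fix
  all variables but one, or restrict to a line, and then use facts about polynomials in one variable.
\<close>

inductive polyfun :: "(('n \<Rightarrow> complex) \<Rightarrow> complex) \<Rightarrow> bool" where
  const: "polyfun (\<lambda>_. c)"
| coord: "polyfun (\<lambda>x. x i)"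
| add: "polyfun f \<Longrightarrow> polyfun g \<Longrightarrow> polyfun (\<lambda>x. f x + g x)"
| mult: "polyfun f \<Longrightarrow> polyfun g \<Longrightarrow> polyfun (\<lambda>x. f x * g x)"

lemma polyfun_diff: "polyfun f \<Longrightarrow> polyfun g \<Longrightarrow> polyfun (\<lambda>x. f x - g x)"
  using polyfun.add[of f "\<lambda>x. (-1) * g x"] polyfun.mult[OF polyfun.const, of g "-1"] by simp

lemma polyfun_sum: "(\<And>i. i \<in> A \<Longrightarrow> polyfun (f i)) \<Longrightarrow> polyfun (\<lambda>x. \<Sum>i\<in>A. f i x)"
  by (induction A rule: infinite_finite_induct) (auto intro: polyfun.intros)

lemma polyfun_prod: "(\<And>i. i \<in> A \<Longrightarrow> polyfun (f i)) \<Longrightarrow> polyfun (\<lambda>x. \<Prod>i\<in>A. f i x)"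
  by (induction A rule: infinite_finite_induct) (auto intro: polyfun.intros)

lemma polyfun_power: "polyfun f \<Longrightarrow> polyfun (\<lambda>x. f x ^ m)"
  by (induction m) (auto intro: polyfun.intros)

lemmas polyfun_intros = polyfun.intros polyfun_diff polyfun_sum polyfun_prod polyfun_power

lemma polyfun_compose:
  "polyfun f \<Longrightarrow> (\<And>i. polyfun (\<lambda>x. g x i)) \<Longrightarrow> polyfun (\<lambda>x. f (g x))"
  by (induction rule: polyfun.induct) (auto intro: polyfun.intros)

lemma polyfun_upd:
  assumes "polyfun f"
  shows "polyfun (\<lambda>x. f (x(i := x i + c)))"
proof -
  have "polyfun (\<lambda>x. (x(i := x i + c)) j)" for j
    using polyfun.add[OF polyfun.coord polyfun.const, of i c] polyfun.coord[of j]
    by (cases "j = i") simp_all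
  from polyfun_compose[of f "\<lambda>x. x(i := x i + c)", OF assms this] show ?thesis .
qed

lemma polyfun_line:
  assumes "polyfun f"
  shows "\<exists>p. \<forall>t. f (\<lambda>i. x i + t * y i) = poly p t"
  using assms
proof induction
  case (const c)
  then show ?case by (intro exI[of _ "[:c:]"]) simp
next
  case (coord i)
  then show ?case by (intro exI[of _ "[:x i, y i:]"]) simp
next
  case (add f g)
  then obtain p q where "\<forall>t. f (\<lambda>i. x i + t * y i) = poly p t" "\<forall>t. g (\<lambda>i. x i + t * y i) = poly q t" by blast
  then show ?case by (intro exI[of _ "p + q"]) simp
next
  case (mult f g)
  then obtain p q where "\<forall>t. f (\<lambda>i. x i + t * y i) = poly p t" "\<forall>t. g (\<lambda>i. x i + t * y i) = poly q t" by blast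
  then show ?case by (intro exI[of _ "p * q"]) simp
qed

text \<open>
  The polynomial ring in \<open>n\<close> variables as polynomials in \<open>x\<^sub>i\<close> over the ring of those functions
  that do not involve \<open>x\<^sub>i\<close>.
\<close>

lemma polyfun_as_poly:
  assumes "polyfun f"
  shows "\<exists>q. (\<forall>x. f x = poly (q x) (x i)) \<and> (\<forall>x z. q (x(i := z)) = q x) \<and>
    (\<forall>m. polyfun (\<lambda>x. coeff (q x) m))"
  using assms
proof induction
  case (const c)
  then show ?case
    by (intro exI[of _ "\<lambda>_. [:c:]"]) (auto intro: polyfun.intros)
next
  case (coord j)
  show ?case
  proof (cases "j = i")
    case True
    then show ?thesis by (intro exI[of _ "\<lambda>_. [:0,1:]"]) (auto intro: polyfun.intros)
  next
    case False
    have "polyfun (\<lambda>x. coeff [:x j:] m)" for m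
      by (cases m) (auto intro: polyfun.intros)
    with False show ?thesis by (intro exI[of _ "\<lambda>x. [:x j:]"]) auto
  qed
next
  case (add f g)
  then obtain p q where
    p: "\<And>x. f x = poly (p x) (x i)" "\<And>x z. p (x(i := z)) = p x" "\<And>m. polyfun (\<lambda>x. coeff (p x) m)" and
    q: "\<And>x. g x = poly (q x) (x i)" "\<And>x z. q (x(i := z)) = q x" "\<And>m. polyfun (\<lambda>x. coeff (q x) m)"
    by blast
  show ?case
  proof (intro exI[of _ "\<lambda>x. p x + q x"] conjI allI)
    show "f x + g x = poly (p x + q x) (x i)" for x by (simp only: p(1) q(1) poly_add)
    show "p (x(i := z)) + q (x(i := z)) = p x + q x" for x z by (simp only: p(2) q(2))
    show "polyfun (\<lambda>x. coeff (p x + q x) m)" for m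
      unfolding coeff_add by (intro polyfun.add p(3) q(3))
  qed
next
  case (mult f g)
  then obtain p q where
    p: "\<And>x. f x = poly (p x) (x i)" "\<And>x z. p (x(i := z)) = p x" "\<And>m. polyfun (\<lambda>x. coeff (p x) m)" and
    q: "\<And>x. g x = poly (q x) (x i)" "\<And>x z. q (x(i := z)) = q x" "\<And>m. polyfun (\<lambda>x. coeff (q x) m)"
    by blast
  show ?case
  proof (intro exI[of _ "\<lambda>x. p x * q x"] conjI allI)
    show "f x * g x = poly (p x * q x) (x i)" for x by (simp only: p(1) q(1) poly_mult)
    show "p (x(i := z)) * q (x(i := z)) = p x * q x" for x z by (simp only: p(2) q(2))
    show "polyfun (\<lambda>x. coeff (p x * q x) m)" for m
      unfolding coeff_mult by (intro polyfun_sum polyfun.mult p(3) q(3))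
  qed
qed

lemma line_ends: "(\<lambda>i. x i + 0 * (y i - x i)) = x" "(\<lambda>i. x i + 1 * (y i - x i)) = (y :: 'n \<Rightarrow> complex)"
  by simp_all

lemma poly_eq_from_cofinite:
  fixes p q :: "complex poly"
  assumes "finite A" "\<And>z. z \<notin> A \<Longrightarrow> poly p z = poly q z"
  shows "p = q"
proof (rule ccontr)
  assume "p \<noteq> q"
  then have "finite {z. poly (p - q) z = 0}" by (intro poly_roots_finite) simp
  moreover have "UNIV \<subseteq> A \<union> {z. poly (p - q) z = 0}" using assms by auto
  ultimately have "finite (UNIV :: complex set)" using assms(1) finite_subset by blast
  then show False using infinite_UNIV_char_0 by blast
qed

text \<open>
  Absence of zero divisors: on the line through a point where \<open>f \<noteq> 0\<close> and one where \<open>g \<noteq> 0\<close>, both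
  would be nonzero polynomials in one variable.
\<close>

lemma polyfun_mult_eq_0:
  assumes "polyfun f" "polyfun g" "\<And>x. f x * g x = 0" "g y \<noteq> 0"
  shows "f x = 0"
proof (rule ccontr)
  assume "f x \<noteq> 0"
  obtain p where p: "\<And>t. f (\<lambda>i. x i + t * (y i - x i)) = poly p t" using polyfun_line[OF assms(1), of x "\<lambda>i. y i - x i"] by blast
  obtain q where q: "\<And>t. g (\<lambda>i. x i + t * (y i - x i)) = poly q t" using polyfun_line[OF assms(2), of x "\<lambda>i. y i - x i"] by blast
  have "poly (p * q) t = poly 0 t" for t using assms(3) by (simp flip: p q)
  then have "p * q = 0" by (intro poly_eq_from_cofinite[of "{}"]) auto
  moreover have "p \<noteq> 0" using p[of 0] \<open>f x \<noteq> 0\<close> by (auto simp: line_ends)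
  moreover have "q \<noteq> 0" using q[of 1] \<open>g y \<noteq> 0\<close> by (auto simp: line_ends)
  ultimately show False by simp
qed

lemma polyfun_unit_const:
  assumes "polyfun f" "polyfun g" "\<And>x. f x * g x = 1"
  shows "f x = f y"
proof -
  obtain p where p: "\<And>t. f (\<lambda>i. x i + t * (y i - x i)) = poly p t" using polyfun_line[OF assms(1), of x "\<lambda>i. y i - x i"] by blast
  obtain q where q: "\<And>t. g (\<lambda>i. x i + t * (y i - x i)) = poly q t" using polyfun_line[OF assms(2), of x "\<lambda>i. y i - x i"] by blast
  have "poly (p * q) t = poly 1 t" for t using assms(3) by (simp flip: p q)
  then have "p * q = 1" by (intro poly_eq_from_cofinite[of "{}"]) auto
  then have "p dvd 1" by (metis dvd_triv_left)
  then obtain c where "p = [:c:]" using is_unit_iff_degree degree_eq_zeroE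
    by (metis dvd_0_left_iff zero_neq_one)
  then show ?thesis using p[of 0] p[of 1] by (simp add: line_ends)
qed

text \<open>
  A polynomial of period \<open>c\<close> takes its value at \<open>0\<close> at all multiples of \<open>c\<close>.
\<close>

lemma poly_periodic_const:
  fixes p :: "complex poly"
  assumes "\<And>z. poly p (z + c) = poly p z" "c \<noteq> 0"
  shows "p = [:coeff p 0:]"
proof -
  have "poly p (of_nat m * c) = poly p 0" for m
    by (induction m) (simp_all add: assms distrib_right add.commute[of c])
  then have "range (\<lambda>m. of_nat m * c) \<subseteq> {z. poly (p - [:poly p 0:]) z = 0}" by auto
  moreover have "inj (\<lambda>m. of_nat m * c)" using \<open>c \<noteq> 0\<close> by (simp add: inj_on_def)
  ultimately have "infinite {z. poly (p - [:poly p 0:]) z = 0}"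
    using finite_subset range_inj_infinite by blast
  then have "p - [:poly p 0:] = 0" using poly_roots_finite by blast
  then show ?thesis by (simp add: poly_0_coeff_0)
qed

lemma polyfun_periodic_indep:
  assumes "polyfun f" "\<And>x. f (x(i := x i + 1)) = f x"
  shows "f (x(i := z)) = f x"
proof -
  obtain q where q: "\<And>x. f x = poly (q x) (x i)" "\<And>x z. q (x(i := z)) = q x"
    using polyfun_as_poly[OF assms(1), of i] by blast
  have "poly (q x) (z + 1) = poly (q x) z" for z
    using assms(2)[of "x(i := z)"] by (simp add: q)
  from poly_periodic_const[OF this one_neq_zero] obtain c where "q x = [:c:]" by (rule that)
  then show ?thesis by (simp add: q)
qed

lemma indep_all_const:
  fixes f :: "('n::finite \<Rightarrow> 'b) \<Rightarrow> 'c"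
  assumes "\<And>i x z. f (x(i := z)) = f x"
  shows "f x = f y"
proof -
  have "f (\<lambda>i. if i \<in> A then y i else x i) = f x" if "finite A" for A
    using that
  proof induction
    case (insert a A)
    have "(\<lambda>i. if i \<in> insert a A then y i else x i) = (\<lambda>i. if i \<in> A then y i else x i)(a := y a)"
      by (auto simp: fun_eq_iff)
    then show ?case using insert assms by metis
  qed simp
  from this[of UNIV] show ?thesis by simp
qed

text \<open>
  The points excluded here lie on finitely many real hyperplanes, and every complex line in the
  direction \<open>(1, \<dots>, 1)\<close> leaves them.  It suffices to look at the imaginary translates of \<open>x\<close>.
\<close>

lemma polyfun_eq_from_generic:
  fixes f :: "('n::finite \<Rightarrow> complex) \<Rightarrow> complex"
  assumes "polyfun f" "polyfun g" "\<And>x. (\<forall>q. Im (x q + a) \<noteq> 0) \<Longrightarrow> f x = g x"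
  shows "f x = g x"
proof -
  obtain p where p: "\<And>t. f (\<lambda>i. x i + t * 1) = poly p t" using polyfun_line[OF assms(1), of x "\<lambda>_. 1"] by blast
  obtain q where q: "\<And>t. g (\<lambda>i. x i + t * 1) = poly q t" using polyfun_line[OF assms(2), of x "\<lambda>_. 1"] by blast
  let ?N = "range (\<lambda>m::nat. \<i> * of_nat m)"
  have "finite (UNIV::'n set)" by simp
  then have "finite ((\<lambda>q. - Im (x q + a)) ` UNIV)" by blast
  then have "finite {m::nat. real m \<in> (\<lambda>q. - Im (x q + a)) ` UNIV}"
    by (rule finite_vimageI[unfolded vimage_def]) (simp add: inj_on_def)
  moreover have "m \<in> {m::nat. real m \<in> (\<lambda>q. - Im (x q + a)) ` UNIV}"
    if "poly (p - q) (\<i> * of_nat m) \<noteq> 0" for m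
  proof (rule ccontr)
    assume *: "m \<notin> {m::nat. real m \<in> (\<lambda>q. - Im (x q + a)) ` UNIV}"
    have "Im (x q + \<i> * of_nat m * 1 + a) \<noteq> 0" for q
    proof
      assume "Im (x q + \<i> * of_nat m * 1 + a) = 0"
      then have "real m = - Im (x q + a)" by simp
      with * show False by blast
    qed
    then have "poly p (\<i> * of_nat m) = poly q (\<i> * of_nat m)"
      using assms(3)[of "\<lambda>q. x q + \<i> * of_nat m * 1"] unfolding p q by blast
    with that show False by simp
  qed
  then have "{m::nat. poly (p - q) (\<i> * of_nat m) \<noteq> 0} \<subseteq> {m::nat. real m \<in> (\<lambda>q. - Im (x q + a)) ` UNIV}"
    by (intro subsetI) (simp only: mem_Collect_eq)
  ultimately have "finite {m::nat. poly (p - q) (\<i> * of_nat m) \<noteq> 0}"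
    by (rule rev_finite_subset)
  moreover have "(UNIV::nat set) = {m. poly (p - q) (\<i> * of_nat m) \<noteq> 0} \<union> {m. poly (p - q) (\<i> * of_nat m) = 0}"
    by auto
  ultimately have "infinite {m::nat. poly (p - q) (\<i> * of_nat m) = 0}"
    by (metis finite_Un infinite_UNIV_nat)
  then have "infinite ((\<lambda>m::nat. \<i> * of_nat m) ` {m::nat. poly (p - q) (\<i> * of_nat m) = 0})"
    by (subst finite_image_iff) (auto simp: inj_on_def)
  moreover have "(\<lambda>m::nat. \<i> * of_nat m) ` {m::nat. poly (p - q) (\<i> * of_nat m) = 0} \<subseteq> {z. poly (p - q) z = 0}" by blast
  ultimately have "infinite {z. poly (p - q) z = 0}" using finite_subset by blast
  then have "p - q = 0" using poly_roots_finite by blast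
  then show ?thesis using p[of 0] q[of 0] by simp
qed

section \<open>Evaluation of polynomials\<close>

definition peval :: "'n::finite mpol \<Rightarrow> ('n \<Rightarrow> complex) \<Rightarrow> complex" where
  "peval p x = (\<Sum>\<alpha>\<in>Poly_Mapping.keys p. Poly_Mapping.lookup p \<alpha> * (\<Prod>i\<in>UNIV. x i ^ Poly_Mapping.lookup \<alpha> i))"

lemma polyfun_peval: "polyfun (peval p)"
  unfolding peval_def by (intro polyfun_intros)

lemma peval_single: "peval (Poly_Mapping.single \<alpha> c) x = c * (\<Prod>i\<in>UNIV. x i ^ Poly_Mapping.lookup \<alpha> i)"
  by (cases "c = 0") (auto simp: peval_def)

lemma peval_add: "peval (p + q) x = peval p x + peval q x"
  unfolding peval_def
  by (rule setsum_keys_plus_distrib) (auto simp: algebra_simps)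

lemma peval_zero: "peval 0 x = 0"
  by (simp add: peval_def)

lemma peval_Const: "peval (Const c) x = c"
  by (simp add: Const_def peval_single)

lemma peval_one: "peval 1 x = 1"
  using peval_Const[of 1] by (simp add: Const_def)

lemma peval_Var: "peval (Var i) x = x i"
  by (simp add: Var_def peval_single lookup_single when_def if_distrib[where f="\<lambda>m. _ ^ m"] cong: if_cong)

lemma peval_mult: "peval (p * q) x = peval p x * peval q x"
proof (induction p rule: mpol_induct)
  case (add f g)
  then show ?case by (simp add: peval_add algebra_simps)
next
  case (single \<alpha> c)
  show ?case
  proof (induction q rule: mpol_induct)
    case (add f g)
    then show ?case by (simp add: peval_add algebra_simps)
  next
    case (single \<beta> d)
    show ?case by (simp add: mult_single peval_single lookup_add power_add prod.distrib)
  qed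
qed

lemma peval_diff: "peval (p - q) x = peval p x - peval q x"
  using peval_add[of "p - q" q x] by simp

lemma peval_sum: "peval (\<Sum>i\<in>A. f i) x = (\<Sum>i\<in>A. peval (f i) x)"
  by (induction A rule: infinite_finite_induct) (auto simp: peval_zero peval_add)

lemma peval_prod: "peval (\<Prod>i\<in>A. f i) x = (\<Prod>i\<in>A. peval (f i) x)"
  by (induction A rule: infinite_finite_induct) (auto simp: peval_one peval_mult)

lemma peval_power: "peval (p ^ m) x = peval p x ^ m"
  by (induction m) (auto simp: peval_one peval_mult)

lemma peval_pscale: "peval (pscale c p) x = c * peval p x"
  by (simp add: pscale_def peval_mult peval_Const)

lemmas peval_simps = peval_add peval_diff peval_mult peval_sum peval_prod peval_power
  peval_Const peval_Var peval_zero peval_one peval_pscale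

lemma peval_psubst: "peval (psubst g p) x = peval p (\<lambda>i. peval (g i) x)"
  by (simp add: psubst_def peval_simps) (simp add: peval_def)

text \<open>
  The argument for the linear independence of characters: doubling \<open>x\<^sub>i\<close> multiplies the monomial with
  exponent \<open>\<alpha>\<close> by \<open>2\<^bsup>\<alpha>\<^sub>i\<^esup>\<close>, and two different monomials are told apart by some \<open>i\<close>.
\<close>

lemma monomials_independent:
  fixes K :: "('n::finite \<Rightarrow>\<^sub>0 nat) set"
  assumes "finite K" "\<And>x. (\<Sum>\<alpha>\<in>K. c \<alpha> * (\<Prod>i\<in>UNIV. x i ^ Poly_Mapping.lookup \<alpha> i)) = (0::complex)" "\<alpha> \<in> K"
  shows "c \<alpha> = 0"
  using assms
proof (induction arbitrary: c \<alpha> rule: finite_induct)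
  case (insert \<beta> K)
  let ?m = "\<lambda>\<alpha> x. \<Prod>i\<in>UNIV. x i ^ Poly_Mapping.lookup \<alpha> i"
  have 0: "c \<gamma> = 0" if "\<gamma> \<in> K" for \<gamma>
  proof -
    from that insert have "\<gamma> \<noteq> \<beta>" by auto
    then obtain i where i: "Poly_Mapping.lookup \<gamma> i \<noteq> Poly_Mapping.lookup \<beta> i"
      by (meson poly_mapping_eqI)
    define d where "d \<alpha> = c \<alpha> * (2 ^ Poly_Mapping.lookup \<alpha> i - 2 ^ Poly_Mapping.lookup \<beta> i)" for \<alpha>
    have m: "?m \<alpha> (x(i := 2 * x i)) = 2 ^ Poly_Mapping.lookup \<alpha> i * ?m \<alpha> x" for \<alpha> :: "'n \<Rightarrow>\<^sub>0 nat" and x :: "'n \<Rightarrow> complex"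
    proof -
      have "?m \<alpha> (x(i := 2 * x i)) = (2 * x i) ^ Poly_Mapping.lookup \<alpha> i * (\<Prod>j\<in>UNIV-{i}. (x(i := 2 * x i)) j ^ Poly_Mapping.lookup \<alpha> j)"
        by (subst prod.remove[of UNIV i]) auto
      also have "(\<Prod>j\<in>UNIV-{i}. (x(i := 2 * x i)) j ^ Poly_Mapping.lookup \<alpha> j) = (\<Prod>j\<in>UNIV-{i}. x j ^ Poly_Mapping.lookup \<alpha> j)"
        by (intro prod.cong) auto
      also have "(2 * x i) ^ Poly_Mapping.lookup \<alpha> i * \<dots> = 2 ^ Poly_Mapping.lookup \<alpha> i * ?m \<alpha> x"
        using prod.remove[of UNIV i "\<lambda>j. x j ^ Poly_Mapping.lookup \<alpha> j"] by (simp add: power_mult_distrib)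
      finally show ?thesis .
    qed
    have "(\<Sum>\<alpha>\<in>K. d \<alpha> * ?m \<alpha> x) = 0" for x
    proof -
      have "(\<Sum>\<alpha>\<in>insert \<beta> K. d \<alpha> * ?m \<alpha> x) = (\<Sum>\<alpha>\<in>insert \<beta> K. c \<alpha> * ?m \<alpha> (x(i := 2 * x i)))
          - 2 ^ Poly_Mapping.lookup \<beta> i * (\<Sum>\<alpha>\<in>insert \<beta> K. c \<alpha> * ?m \<alpha> x)"
        unfolding m d_def sum_distrib_left by (simp only: sum_subtractf[symmetric]) (simp add: algebra_simps)
      also have "\<dots> = 0" using insert.prems(1) by simp
      finally show ?thesis using insert.hyps by (simp add: d_def)
    qed
    from insert.IH[OF this \<open>\<gamma> \<in> K\<close>] have "d \<gamma> = 0" .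
    moreover have "(2::complex) ^ Poly_Mapping.lookup \<gamma> i \<noteq> 2 ^ Poly_Mapping.lookup \<beta> i"
    proof
      assume "(2::complex) ^ Poly_Mapping.lookup \<gamma> i = 2 ^ Poly_Mapping.lookup \<beta> i"
      then have "of_nat (2 ^ Poly_Mapping.lookup \<gamma> i) = (of_nat (2 ^ Poly_Mapping.lookup \<beta> i) :: complex)"
        by simp
      then show False using i by (simp only: of_nat_eq_iff) simp
    qed
    ultimately show ?thesis by (simp add: d_def)
  qed
  moreover have "c \<beta> = 0"
    using insert.prems(1)[of "\<lambda>_. 1"] insert.hyps 0 by simp
  ultimately show ?case using insert.prems by auto
qed simp

lemma peval_inject: "(\<And>x. peval p x = peval q x) \<Longrightarrow> p = q"
proof -
  assume *: "\<And>x. peval p x = peval q x"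
  have "Poly_Mapping.lookup (p - q) \<alpha> = 0" for \<alpha>
  proof (cases "\<alpha> \<in> Poly_Mapping.keys (p - q)")
    case True
    have "(\<Sum>\<alpha>\<in>Poly_Mapping.keys (p - q). Poly_Mapping.lookup (p - q) \<alpha> * (\<Prod>i\<in>UNIV. x i ^ Poly_Mapping.lookup \<alpha> i)) = 0" for x
      using *[of x] peval_diff[of p q x] by (simp add: peval_def)
    from monomials_independent[OF _ this True] show ?thesis by simp
  qed (simp add: in_keys_iff)
  then show "p = q" by (simp add: poly_mapping_eq_iff fun_eq_iff lookup_minus)
qed

section \<open>The difference equations of a module\<close>

text \<open>
  \<open>F k i\<close> describes the action of \<open>t\<^sup>k \<partial>\<^sub>i\<close> on the generator, and \<open>bracket\<close> is the commutation
  relation \<open>[t\<^sup>r \<partial>\<^sub>i, t\<^sup>s \<partial>\<^sub>j] = s\<^sub>i t\<^sup>r\<^sup>+\<^sup>s \<partial>\<^sub>j - r\<^sub>j t\<^sup>r\<^sup>+\<^sup>s \<partial>\<^sub>i\<close> applied to it.  When \<open>r + s\<close> is not an admissible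
  exponent for one of the terms on the right, the coefficient of this term is \<open>0\<close>.
\<close>

locale shift_system =
  fixes F :: "('n::finite \<Rightarrow> int) \<Rightarrow> 'n \<Rightarrow> ('n \<Rightarrow> complex) \<Rightarrow> complex"
  assumes polyfun_F: "polyfun (F k i)"
    and F_zero: "F (\<lambda>_. 0) i x = x i"
    and bracket: "r \<in> Zplus i \<Longrightarrow> s \<in> Zplus j \<Longrightarrow>
      F s j (\<lambda>l. x l - of_int (r l)) * F r i x - F r i (\<lambda>l. x l - of_int (s l)) * F s j x =
      of_int (s i) * F (\<lambda>l. r l + s l) j x - of_int (r j) * F (\<lambda>l. r l + s l) i x"
begin

text \<open>
  The polynomials of \<open>\<partial>/\<partial>t\<^sub>i\<close>, of \<open>t\<^sub>i \<partial>\<^sub>j\<close>, and (for \<open>i \<noteq> j\<close>) of \<open>t\<^sub>i \<partial>/\<partial>t\<^sub>j\<close>.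
\<close>

definition D where "D i = F (\<lambda>l. - of_bool (l = i)) i"
definition T where "T i j = F (\<lambda>l. of_bool (l = i)) j"
definition N where "N i j = F (\<lambda>l. of_bool (l = i) - of_bool (l = j)) j"

lemma polyfun_D: "polyfun (D i)" and polyfun_T: "polyfun (T i j)"
  by (simp_all add: D_def T_def polyfun_F)

lemma shift_plus: "(\<lambda>l. x l + of_bool (l = i)) = x(i := x i + (1 :: complex))"
  and shift_minus: "(\<lambda>l. x l - of_bool (l = i)) = x(i := x i - (1 :: complex))"
  and shift_diff: "i \<noteq> j \<Longrightarrow> (\<lambda>l. x l - (of_bool (l = i) - of_bool (l = j) :: complex)) =
    x(i := x i - 1, j := x j + 1)"
  by (auto simp: fun_eq_iff)

lemmas shifts = shift_plus shift_minus shift_diff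

lemma bracket_D_D:
  "i \<noteq> j \<Longrightarrow> D j (x(i := x i + 1)) * D i x = D i (x(j := x j + 1)) * D j x"
  using bracket[of "\<lambda>l. - of_bool (l = i)" i "\<lambda>l. - of_bool (l = j)" j x]
  by (simp add: Zplus_def shifts D_def)

lemma bracket_D_T_diag:
  "T i i (x(i := x i + 1)) * D i x - D i (x(i := x i - 1)) * T i i x = 2 * x i"
  using bracket[of "\<lambda>l. - of_bool (l = i)" i "\<lambda>l. of_bool (l = i)" i x]
  by (simp add: Zplus_def shifts D_def T_def F_zero)

lemma bracket_D_T_same:
  "i \<noteq> j \<Longrightarrow> T i j (x(i := x i + 1)) * D i x - D i (x(i := x i - 1)) * T i j x = x j"
  using bracket[of "\<lambda>l. - of_bool (l = i)" i "\<lambda>l. of_bool (l = i)" j x]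
  by (simp add: Zplus_def shifts D_def T_def F_zero)

lemma bracket_D_T_other:
  "k \<noteq> i \<Longrightarrow> k \<noteq> j \<Longrightarrow> T i j (x(k := x k + 1)) * D k x = D k (x(i := x i - 1)) * T i j x"
  using bracket[of "\<lambda>l. - of_bool (l = k)" k "\<lambda>l. of_bool (l = i)" j x]
  by (simp add: Zplus_def shifts D_def T_def F_zero)

lemma bracket_D_T_N:
  "i \<noteq> j \<Longrightarrow> T i j (x(j := x j + 1)) * D j x - D j (x(i := x i - 1)) * T i j x = N i j x"
  using bracket[of "\<lambda>l. - of_bool (l = j)" j "\<lambda>l. of_bool (l = i)" j x]
  by (simp add: Zplus_def shifts D_def T_def N_def)

lemma bracket_D_N:
  "i \<noteq> j \<Longrightarrow> N i j (x(j := x j + 1)) * D j x = D j (x(i := x i - 1, j := x j + 1)) * N i j x"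
  using bracket[of "\<lambda>l. - of_bool (l = j)" j "\<lambda>l. of_bool (l = i) - of_bool (l = j)" j x]
  by (simp add: Zplus_def shifts D_def N_def)

lemma bracket_N_T:
  "i \<noteq> j \<Longrightarrow> T j j (x(i := x i - 1, j := x j + 1)) * N i j x - N i j (x(j := x j - 1)) * T j j x
     = 2 * T i j x"
  using bracket[of "\<lambda>l. of_bool (l = i) - of_bool (l = j)" j "\<lambda>l. of_bool (l = j)" j x]
  by (simp add: Zplus_def shifts T_def N_def)

text \<open>
  Both \<open>[t\<^sub>i \<partial>\<^sub>j, t\<^sub>i \<partial>/\<partial>t\<^sub>j]\<close> and \<open>[t\<^sub>i \<partial>/\<partial>t\<^sub>j, t\<^sub>i \<partial>\<^sub>i]\<close> are \<open>- t\<^sub>i\<^sup>2 \<partial>/\<partial>t\<^sub>j\<close>.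
\<close>

lemma bracket_T_N_T:
  assumes "i \<noteq> j"
  shows "N i j (x(i := x i - 1)) * T i j x - T i j (x(i := x i - 1, j := x j + 1)) * N i j x =
    T i i (x(i := x i - 1, j := x j + 1)) * N i j x - N i j (x(i := x i - 1)) * T i i x"
proof -
  have "(\<lambda>l. of_bool (l = i) - of_bool (l = j) + of_bool (l = i)) =
      (\<lambda>l. of_bool (l = i) + (of_bool (l = i) - of_bool (l = j)) :: int)" by auto
  then show ?thesis
    using bracket[of "\<lambda>l. of_bool (l = i)" j "\<lambda>l. of_bool (l = i) - of_bool (l = j)" j x]
      bracket[of "\<lambda>l. of_bool (l = i) - of_bool (l = j)" j "\<lambda>l. of_bool (l = i)" i x] assms
    by (simp add: Zplus_def shifts T_def N_def)
qed

lemma bracket_N_N_opposite: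
  "i \<noteq> j \<Longrightarrow> N i j (x(j := x j - 1, i := x i + 1)) * N j i x - N j i (x(i := x i - 1, j := x j + 1)) * N i j x
     = x j - x i"
  using bracket[of "\<lambda>l. of_bool (l = j) - of_bool (l = i)" i "\<lambda>l. of_bool (l = i) - of_bool (l = j)" j x]
  by (simp add: Zplus_def shifts N_def F_zero)

lemma bracket_N_N_compose:
  "i \<noteq> j \<Longrightarrow> j \<noteq> k \<Longrightarrow> i \<noteq> k \<Longrightarrow>
     N j k (x(i := x i - 1, j := x j + 1)) * N i j x - N i j (x(j := x j - 1, k := x k + 1)) * N j k x
     = N i k x"
  using bracket[of "\<lambda>l. of_bool (l = i) - of_bool (l = j)" j "\<lambda>l. of_bool (l = j) - of_bool (l = k)" k x]
  by (simp add: Zplus_def shifts N_def)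

end

section \<open>The action of the partial derivatives\<close>

text \<open>
  The difference equations integrate to \<open>h g = x\<^sub>i x\<^sub>j + c'\<close> and \<open>k g = x\<^sub>i\<^sup>2 - x\<^sub>i + c\<close> with \<open>c\<close>, \<open>c'\<close> free of
  \<open>x\<^sub>i\<close>.  The first equation bounds the degree of \<open>g\<close> in \<open>x\<^sub>i\<close> by \<open>1\<close>.  By the second, the leading
  coefficient of \<open>g\<close> in \<open>x\<^sub>i\<close> divides \<open>1\<close>, so it is a nonzero constant.
\<close>

lemma factor_dichotomy:
  fixes g h k :: "('n \<Rightarrow> complex) \<Rightarrow> complex"
  assumes "polyfun g" "polyfun h" "polyfun k" "i \<noteq> j"
    and h: "\<And>x. h (x(i := x i + 1)) * g (x(i := x i + 1)) - h x * g x = x j"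
    and k: "\<And>x. k (x(i := x i + 1)) * g (x(i := x i + 1)) - k x * g x = 2 * x i"
  shows "\<exists>c. c \<noteq> 0 \<and> ((\<forall>x. g x = c) \<or>
    (\<exists>b. polyfun b \<and> (\<forall>x z. b (x(i := z)) = b x) \<and> (\<forall>x. g x = c * (x i + b x))))"
proof -
  obtain g' where g': "\<And>x. g x = poly (g' x) (x i)" "\<And>x z. g' (x(i := z)) = g' x"
    "\<And>m. polyfun (\<lambda>x. coeff (g' x) m)"
    using polyfun_as_poly[OF assms(1), of i] by blast
  obtain h' where h': "\<And>x. h x = poly (h' x) (x i)" "\<And>x z. h' (x(i := z)) = h' x"
    "\<And>m. polyfun (\<lambda>x. coeff (h' x) m)"
    using polyfun_as_poly[OF assms(2), of i] by blast
  obtain k' where k': "\<And>x. k x = poly (k' x) (x i)" "\<And>x z. k' (x(i := z)) = k' x"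
    "\<And>m. polyfun (\<lambda>x. coeff (k' x) m)"
    using polyfun_as_poly[OF assms(3), of i] by blast
  \<comment> \<open>Subtracting a particular solution leaves a polynomial of period 1 in \<open>x\<^sub>i\<close>.\<close>
  have hg: "\<exists>c. h' x * g' x = [:c, x j:]" for x
  proof -
    have "poly (h' x * g' x - [:0, x j:]) (z + 1) = poly (h' x * g' x - [:0, x j:]) z" for z
      using h[of "x(i := z)"] \<open>i \<noteq> j\<close> by (simp add: g' h' algebra_simps)
    from poly_periodic_const[OF this one_neq_zero] have "h' x * g' x = [:coeff (h' x * g' x - [:0, x j:]) 0:] + [:0, x j:]"
      by (simp add: algebra_simps)
    then show ?thesis by (metis add_pCons add_0 add.right_neutral)
  qed
  have kg: "\<exists>c. k' x * g' x = [:c, -1, 1:]" for x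
  proof -
    have "poly (k' x * g' x - [:0, -1, 1:]) (z + 1) = poly (k' x * g' x - [:0, -1, 1:]) z" for z
      using k[of "x(i := z)"] by (simp add: g' k' algebra_simps)
    from poly_periodic_const[OF this one_neq_zero] have "k' x * g' x = [:coeff (k' x * g' x - [:0, -1, 1:]) 0:] + [:0, -1, 1:]"
      by (simp add: algebra_simps)
    then show ?thesis by (metis add_pCons add_0 add.right_neutral)
  qed
  have degree_kg: "degree (k' x) + degree (g' x) = 2" for x
  proof -
    obtain c where c: "k' x * g' x = [:c, -1, 1:]" using kg by blast
    then have "k' x \<noteq> 0" "g' x \<noteq> 0" by auto
    then have "degree (k' x) + degree (g' x) = degree (k' x * g' x)" by (simp add: degree_mult_eq)
    then show ?thesis unfolding c by simp
  qed
  \<comment> \<open>Where \<open>x\<^sub>j \<noteq> 0\<close> the product \<open>h g\<close> has degree exactly 1; the other points follow by density.\<close>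
  have coeff_g: "coeff (g' x) m = 0" if "m \<ge> 2" for x m
  proof (rule polyfun_mult_eq_0[where f = "\<lambda>x. coeff (g' x) m" and g = "\<lambda>x. x j" and y = "\<lambda>_. 1"])
    show "coeff (g' x) m * x j = 0" for x
    proof (cases "x j = 0")
      case False
      obtain c where c: "h' x * g' x = [:c, x j:]" using hg by blast
      with False have "h' x \<noteq> 0" "g' x \<noteq> 0" by auto
      then have "degree (h' x) + degree (g' x) = degree (h' x * g' x)" by (simp add: degree_mult_eq)
      also have "\<dots> = 1" unfolding c using False by simp
      finally show ?thesis using that by (simp add: coeff_eq_0)
    qed simp
  qed (simp_all add: g' polyfun.coord)
  have g_linear: "g' x = [:coeff (g' x) 0, coeff (g' x) 1:]" for x
    using coeff_g by (auto intro!: poly_eqI simp: coeff_pCons numeral_2_eq_2 split: nat.splits)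
  show ?thesis
  proof (cases "\<exists>y. coeff (g' y) 1 \<noteq> 0")
    case False
    then have g_const: "g' x = [:coeff (g' x) 0:]" for x using g_linear[of x] by simp
    have "coeff (g' x) 0 * coeff (k' x) 2 = 1" for x
    proof -
      obtain c where c: "k' x * g' x = [:c, -1, 1:]" using kg by blast
      have "k' x * g' x = smult (coeff (g' x) 0) (k' x)" by (subst g_const) simp
      then show ?thesis using c by (metis coeff_smult coeff_pCons_Suc coeff_pCons_0 numeral_2_eq_2)
    qed
    note unit = this
    have "coeff (g' x) 0 = coeff (g' y) 0" for x y
      by (rule polyfun_unit_const[OF g'(3) k'(3)]) (rule unit)
    moreover have "coeff (g' x) 0 \<noteq> 0" for x using unit[of x] by auto
    moreover have "g x = coeff (g' x) 0" for x unfolding g' by (subst g_const) simp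
    ultimately show ?thesis by metis
  next
    case True
    then obtain y where y: "coeff (g' y) 1 \<noteq> 0" by blast
    have "coeff (k' x) m = 0" if "m \<ge> 2" for x m
    proof (rule polyfun_mult_eq_0[OF k'(3) g'(3)])
      show "coeff (k' x) m * coeff (g' x) 1 = 0" for x
      proof (cases "coeff (g' x) 1 = 0")
        case False
        then have "degree (g' x) \<ge> 1" by (simp add: le_degree)
        with degree_kg[of x] that show ?thesis by (simp add: coeff_eq_0)
      qed simp
    qed (rule y)
    then have k_linear: "k' x = [:coeff (k' x) 0, coeff (k' x) 1:]" for x
      by (auto intro!: poly_eqI simp: coeff_pCons numeral_2_eq_2 split: nat.splits)
    have unit: "coeff (g' x) 1 * coeff (k' x) 1 = 1" for x
    proof -
      obtain c where c: "k' x * g' x = [:c, -1, 1:]" using kg by blast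
      moreover have "coeff ([:coeff (k' x) 0, coeff (k' x) 1:] * [:coeff (g' x) 0, coeff (g' x) 1:]) 2 = coeff (g' x) 1 * coeff (k' x) 1"
        by (simp add: numeral_2_eq_2)
      ultimately show ?thesis
        unfolding g_linear[symmetric] k_linear[symmetric] by (simp add: numeral_2_eq_2)
    qed
    have const: "coeff (g' x) 1 = coeff (g' y) 1" for x
      by (rule polyfun_unit_const[OF g'(3) k'(3)]) (rule unit)
    define b where "b x = coeff (g' x) 0 * inverse (coeff (g' y) 1)" for x
    have "polyfun b" unfolding b_def by (intro polyfun.mult g'(3) polyfun.const)
    moreover have "b (x(i := z)) = b x" for x z by (simp add: b_def g')
    moreover have "g x = coeff (g' y) 1 * (x i + b x)" for x
    proof -
      have "g x = coeff (g' x) 0 + x i * coeff (g' x) 1"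
        unfolding g'(1) by (subst g_linear) simp
      then show ?thesis using y const[of x] by (simp add: b_def field_simps)
    qed
    ultimately show ?thesis using y by blast
  qed
qed

text \<open>
  \<open>(x\<^sub>i - 1 + b) u\<close> has period \<open>1\<close> in \<open>x\<^sub>i\<close>, so it does not involve \<open>x\<^sub>i\<close>; but it vanishes at
  \<open>x\<^sub>i = 1 - b\<close>.
\<close>

lemma difference_equation_unique:
  assumes "polyfun b" "\<And>x z. b (x(i := z)) = b x" "polyfun u"
    and eq: "\<And>x. u (x(i := x i + 1)) * (x i + b x) = (x i - 1 + b x) * u x"
  shows "u x = 0"
proof -
  let ?w = "\<lambda>x. (x i - 1 + b x) * u x"
  have w: "polyfun ?w"
    by (intro polyfun.mult polyfun.add polyfun_diff polyfun.coord polyfun.const assms(1,3))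
  have "?w (x(i := x i + 1)) = ?w x" for x
    using eq[of x] by (simp add: assms(2) mult.commute)
  then have "?w (x(i := 1 - b x)) = ?w x" for x
    by (rule polyfun_periodic_indep[OF w])
  then have *: "u x * (x i - 1 + b x) = 0" for x by (simp add: assms(2) mult.commute)
  show ?thesis
  proof (rule polyfun_mult_eq_0[where f = u and g = "\<lambda>x. x i - 1 + b x" and y = "(\<lambda>_. 0)(i := 2 - b (\<lambda>_. 0))"])
    show "u x * (x i - 1 + b x) = 0" for x by (rule *)
    show "polyfun (\<lambda>x. x i - 1 + b x)"
      by (intro polyfun.add polyfun_diff polyfun.coord polyfun.const assms(1))
    show "((\<lambda>_. 0)(i := 2 - b (\<lambda>_. 0))) i - 1 + b ((\<lambda>_. 0)(i := 2 - b (\<lambda>_. 0))) \<noteq> 0"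
      by (simp add: assms(2))
  qed (fact assms)
qed

lemma cancel_scalars:
  fixes a :: complex
  assumes "\<mu> \<noteq> 0" "\<nu> \<noteq> 0"
  shows "a / \<mu> * (b / \<nu>) = c / \<nu> * (d / \<mu>) \<longleftrightarrow> a * b = c * d"
    and "\<mu> * a * (b / \<nu>) = c / \<nu> * (\<mu> * d) \<longleftrightarrow> a * b = c * d"
  using assms by (simp_all add: field_simps)

lemma ex_other_index:
  assumes "CARD('a) > 1"
  obtains j where "i \<noteq> (j :: 'a)"
proof (rule ccontr)
  assume "\<not> thesis"
  then have "j = i" for j using that[of j] by (cases "i = j") auto
  then have "(UNIV :: 'a set) = {i}" by auto
  then have "CARD('a) = 1" by (metis card_1_singleton_iff One_nat_def)
  with assms show False by simp
qed

context shift_system begin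

lemma D_dichotomy:
  assumes "i \<noteq> j"
  shows "\<exists>\<mu>. \<mu> \<noteq> 0 \<and> ((\<forall>x. D i x = 1 / \<mu>) \<or>
    (\<exists>b. polyfun b \<and> (\<forall>x z. b (x(i := z)) = b x) \<and> (\<forall>x. D i x = (x i + b x) / \<mu>)))"
proof -
  let ?g = "\<lambda>x. D i (x(i := x i + (-1)))"
  have "\<exists>c. c \<noteq> 0 \<and> ((\<forall>x. ?g x = c) \<or>
    (\<exists>b. polyfun b \<and> (\<forall>x z. b (x(i := z)) = b x) \<and> (\<forall>x. ?g x = c * (x i + b x))))"
  proof (rule factor_dichotomy)
    show "polyfun ?g" by (rule polyfun_upd[OF polyfun_D])
    show "polyfun (T i j)" "polyfun (T i i)" by (rule polyfun_T)+
    show "T i j (x(i := x i + 1)) * ?g (x(i := x i + 1)) - T i j x * ?g x = x j" for x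
      using bracket_D_T_same[OF assms, of x] by (simp add: mult.commute)
    show "T i i (x(i := x i + 1)) * ?g (x(i := x i + 1)) - T i i x * ?g x = 2 * x i" for x
      using bracket_D_T_diag[of i x] by (simp add: mult.commute)
  qed (fact assms)
  then obtain c where c: "c \<noteq> 0" and alt: "(\<forall>x. ?g x = c) \<or>
    (\<exists>b. polyfun b \<and> (\<forall>x z. b (x(i := z)) = b x) \<and> (\<forall>x. ?g x = c * (x i + b x)))" by blast
  from alt show ?thesis
  proof
    assume "\<forall>x. ?g x = c"
    from spec[OF this] have "?g (x(i := x i + 1)) = c" for x .
    then have "D i x = 1 / inverse c" for x by (simp add: field_simps)
    then show ?thesis using c by (intro exI[of _ "inverse c"]) simp
  next
    assume "\<exists>b. polyfun b \<and> (\<forall>x z. b (x(i := z)) = b x) \<and> (\<forall>x. ?g x = c * (x i + b x))"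
    then obtain b where b: "polyfun b" "\<And>x z. b (x(i := z)) = b x" "\<And>x. ?g x = c * (x i + b x)" by blast
    have "D i x = (x i + (b x + 1)) / inverse c" for x
      using b(3)[of "x(i := x i + 1)"] by (simp add: b(2) field_simps)
    moreover have "polyfun (\<lambda>x. b x + 1)" using polyfun.add[OF b(1) polyfun.const] .
    ultimately show ?thesis using c b(2)
      by (intro exI[of _ "inverse c"] conjI disjI2 exI[of _ "\<lambda>x. b x + 1"]) simp_all
  qed
qed

text \<open>
  The right-hand sides solve the difference equations that come from bracketing with \<open>\<partial>/\<partial>t\<^sub>i\<close>, and
  these have only one solution.
\<close>

lemma T_linear:
  assumes "polyfun b" "\<And>x z. b (x(i := z)) = b x" "\<And>x. D i x = (x i + b x) / \<mu>" "\<mu> \<noteq> 0"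
  shows "j \<noteq> i \<Longrightarrow> T i j x = \<mu> * x j" "T i i x = \<mu> * (x i - b x)"
proof -
  assume "j \<noteq> i"
  have "T i j x - \<mu> * x j = 0"
  proof (rule difference_equation_unique[where u = "\<lambda>x. T i j x - \<mu> * x j", OF assms(1,2)])
    show "polyfun (\<lambda>x. T i j x - \<mu> * x j)"
      by (intro polyfun_diff polyfun.mult polyfun.const polyfun.coord polyfun_T)
    show "(T i j (x(i := x i + 1)) - \<mu> * (x(i := x i + 1)) j) * (x i + b x) = (x i - 1 + b x) * (T i j x - \<mu> * x j)" for x
    proof -
      have "(T i j (x(i := x i + 1)) * (x i + b x) - (x i - 1 + b x) * T i j x) / \<mu> = x j"
        using bracket_D_T_same[of i j x] \<open>j \<noteq> i\<close> by (simp add: assms(2,3) diff_divide_distrib)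
      then have "T i j (x(i := x i + 1)) * (x i + b x) - (x i - 1 + b x) * T i j x = \<mu> * x j"
        using \<open>\<mu> \<noteq> 0\<close> by (simp add: field_simps)
      then show ?thesis using \<open>j \<noteq> i\<close> by (simp add: algebra_simps)
    qed
  qed
  then show "T i j x = \<mu> * x j" by simp
next
  have "T i i x - \<mu> * (x i - b x) = 0"
  proof (rule difference_equation_unique[where u = "\<lambda>x. T i i x - \<mu> * (x i - b x)", OF assms(1,2)])
    show "polyfun (\<lambda>x. T i i x - \<mu> * (x i - b x))"
      by (intro polyfun_diff polyfun.mult polyfun.const polyfun.coord polyfun_T assms(1))
    show "(T i i (x(i := x i + 1)) - \<mu> * ((x(i := x i + 1)) i - b (x(i := x i + 1)))) * (x i + b x) =
        (x i - 1 + b x) * (T i i x - \<mu> * (x i - b x))" for x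
    proof -
      have "(T i i (x(i := x i + 1)) * (x i + b x) - (x i - 1 + b x) * T i i x) / \<mu> = 2 * x i"
        using bracket_D_T_diag[of i x] by (simp add: assms(2,3) diff_divide_distrib)
      then have "T i i (x(i := x i + 1)) * (x i + b x) - (x i - 1 + b x) * T i i x = \<mu> * (2 * x i)"
        using \<open>\<mu> \<noteq> 0\<close> by (simp add: field_simps)
      then show ?thesis by (simp add: assms(2) algebra_simps)
    qed
  qed
  then show "T i i x = \<mu> * (x i - b x)" by simp
qed

text \<open>
  Let \<open>i \<notin> S\<close> and \<open>j \<noteq> i\<close>; the claim is that \<open>b\<^sub>i\<close> does not involve \<open>x\<^sub>j\<close>.  If \<open>j \<in> S\<close>, this is
  \<open>[\<partial>/\<partial>t\<^sub>i, \<partial>/\<partial>t\<^sub>j] = 0\<close>.  If \<open>j \<notin> S\<close>, add to this relation the relation \<open>[\<partial>/\<partial>t\<^sub>i, t\<^sub>j \<partial>\<^sub>j] = 0\<close>.  With all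
  variables but \<open>z = x\<^sub>j\<close> and \<open>y = x\<^sub>i\<close> fixed, and \<open>u(z) = b\<^sub>i\<close>, \<open>w(y) = b\<^sub>j\<close>, the sum reads
  \<open>z (u(z+1) + u(z-1) - 2 u(z)) + w(y) (u(z+1) - u(z-1)) = 0\<close>.  Either \<open>u\<close> has period \<open>2\<close>, so it is
  constant, or \<open>w\<close> is a constant \<open>c\<close>.  In the second case \<open>[\<partial>/\<partial>t\<^sub>i, \<partial>/\<partial>t\<^sub>j] = 0\<close> becomes
  \<open>(z + c) (u(z+1) - u(z)) = 0\<close>.
\<close>

lemma b_const:
  assumes "\<And>i. \<mu> i \<noteq> 0"
    and const: "\<And>i x. i \<in> S \<Longrightarrow> D i x = 1 / \<mu> i"
    and b: "\<And>i. i \<notin> S \<Longrightarrow> polyfun (b i)" "\<And>i x z. i \<notin> S \<Longrightarrow> b i (x(i := z)) = b i x"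
    and linear: "\<And>i x. i \<notin> S \<Longrightarrow> D i x = (x i + b i x) / \<mu> i"
    and i: "i \<notin> S"
  shows "b i x = b i y"
proof (rule indep_all_const[where f = "b i"])
  fix j and x :: "'n \<Rightarrow> complex" and z
  have "b i (x(j := x j + 1)) = b i x" if "i \<noteq> j" for x
  proof (cases "j \<in> S")
    case True
    then show ?thesis
      using bracket_D_D[OF that, of x] that by (simp add: const linear i assms(1) b(2) mult.commute[of "\<mu> j"])
  next
    case j: False
    note D = linear[OF i] linear[OF j]
    note T_jj = T_linear(2)[OF b(1)[OF j] b(2)[OF j] linear[OF j] assms(1)]
    have DD: "(x j + b j (x(i := x i + 1))) * (x i + b i x) = (x i + b i (x(j := x j + 1))) * (x j + b j x)" for x
      using bracket_D_D[OF that, of x] that assms(1) by (simp add: D mult.commute[of "\<mu> j"])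
    have DT: "(x j - b j (x(i := x i + 1))) * (x i + b i x) = (x i + b i (x(j := x j - 1))) * (x j - b j x)" for x
      using bracket_D_T_other[of i j j, OF that that, of x] that assms(1) by (simp add: D T_jj cancel_scalars(2))
    have sum: "x j * (b i (x(j := x j + 1)) + b i (x(j := x j - 1)) - 2 * b i x) +
        b j x * (b i (x(j := x j + 1)) - b i (x(j := x j - 1))) = 0" for x
      using arg_cong2[OF DD[of x] DT[of x], of "(+)"] by (simp add: algebra_simps)
    obtain q where q: "\<And>x. b i x = poly (q x) (x j)" "\<And>x z. q (x(j := z)) = q x"
      using polyfun_as_poly[OF b(1)[OF i], of j] by blast
    have q_i: "poly (q (x(i := y))) z = poly (q x) z" for x y z
      using b(2)[OF i, of "x(j := z)" y] \<open>i \<noteq> j\<close> by (simp add: q fun_upd_twist[of j i])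
    have "poly (q x) (x j + 1) = poly (q x) (x j)"
    proof (cases "\<exists>z. poly (q x) (z + 1) \<noteq> poly (q x) (z - 1)")
      case False
      then have "poly (q x) (z + 2) = poly (q x) z" for z
        by (metis add_diff_cancel_right' one_add_one add.assoc)
      from poly_periodic_const[OF this] obtain c where "q x = [:c:]" by (auto intro: that)
      then show ?thesis by simp
    next
      case True
      then obtain z where z: "poly (q x) (z + 1) \<noteq> poly (q x) (z - 1)" by blast
      define c where "c = - z * (poly (q x) (z + 1) + poly (q x) (z - 1) - 2 * poly (q x) z) /
        (poly (q x) (z + 1) - poly (q x) (z - 1))"
      have v: "b j (x(i := y)) = c" for y
        using sum[of "x(i := y, j := z)"] z \<open>i \<noteq> j\<close> b(2)[OF j]
        by (simp add: q q_i c_def field_simps)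
      have "poly (pcompose (q x) [:1, 1:]) w = poly (q x) w" if "w \<notin> {-c}" for w
      proof -
        have "w + c \<noteq> 0" using that by (auto simp: add_eq_0_iff2)
        then show ?thesis
          using DD[of "x(i := 0, j := w)"] \<open>i \<noteq> j\<close>
          by (simp add: q q_i b(2)[OF j] v fun_upd_twist[of j i] poly_pcompose add.commute)
      qed
      then have "pcompose (q x) [:1, 1:] = q x" by (intro poly_eq_from_cofinite[of "{-c}"]) simp_all
      from arg_cong[OF this, of "\<lambda>p. poly p (x j)"] show ?thesis
        by (simp add: poly_pcompose add.commute)
    qed
    then show ?thesis by (simp add: q)
  qed
  then show "b i (x(j := z)) = b i x"
    using polyfun_periodic_indep[OF b(1)[OF i], of j x z] b(2)[OF i] by (cases "i = j") auto
qed

lemma lowering_classification: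
  assumes "CARD('n) > 1"
  shows "\<exists>\<mu> S \<beta>. (\<forall>i. \<mu> i \<noteq> 0) \<and> (\<forall>i x. D i x = (if i \<in> S then 1 else x i + \<beta> i) / \<mu> i)"
proof -
  let ?lin = "\<lambda>\<mu> i b. polyfun b \<and> (\<forall>x z. b (x(i := z)) = b x) \<and> (\<forall>x. D i x = (x i + b x) / \<mu>)"
  have "\<exists>\<mu>. \<mu> \<noteq> 0 \<and> ((\<forall>x. D i x = 1 / \<mu>) \<or> (\<exists>b. ?lin \<mu> i b))" for i
  proof -
    obtain j where "i \<noteq> j" using ex_other_index[OF assms] .
    from D_dichotomy[OF this] show ?thesis .
  qed
  then have "\<exists>\<mu>. \<forall>i. \<mu> i \<noteq> 0 \<and> ((\<forall>x. D i x = 1 / \<mu> i) \<or> (\<exists>b. ?lin (\<mu> i) i b))"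
    by (intro choice allI)
  then obtain \<mu> where \<mu>: "\<And>i. \<mu> i \<noteq> 0" "\<And>i. (\<forall>x. D i x = 1 / \<mu> i) \<or> (\<exists>b. ?lin (\<mu> i) i b)"
    by blast
  define S where "S = {i. \<forall>x. D i x = 1 / \<mu> i}"
  have "\<forall>i. \<exists>b. i \<notin> S \<longrightarrow> ?lin (\<mu> i) i b" using \<mu>(2) by (auto simp: S_def)
  from choice[OF this] obtain b where b: "\<And>i. i \<notin> S \<Longrightarrow> ?lin (\<mu> i) i (b i)" by blast
  have D_S: "D i x = 1 / \<mu> i" if "i \<in> S" for i x using that by (simp add: S_def)
  have b_props: "polyfun (b i)" "b i (x(i := z)) = b i x" "D i x = (x i + b i x) / \<mu> i" if "i \<notin> S" for i x z
    using b[OF that] by blast+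
  note const = b_const[where \<mu> = \<mu> and S = S and b = b, OF \<mu>(1) D_S b_props]
  have "D i x = (if i \<in> S then 1 else x i + b i (\<lambda>_. 0)) / \<mu> i" for i x
    using D_S[of i x] b_props(3)[of i x] const[of i x "\<lambda>_. 0"] by (cases "i \<in> S") simp_all
  with \<mu>(1) show ?thesis
    by (intro exI[of _ \<mu>] exI[of _ S] exI[of _ "\<lambda>i. b i (\<lambda>_. 0)"] conjI allI)
qed

end

section \<open>The action of linear and quadratic generators\<close>

locale classified_shift_system = shift_system F
  for F :: "('n::finite \<Rightarrow> int) \<Rightarrow> 'n \<Rightarrow> ('n \<Rightarrow> complex) \<Rightarrow> complex" +
  fixes \<mu> :: "'n \<Rightarrow> complex" and S :: "'n set" and \<beta> :: "'n \<Rightarrow> complex"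
  assumes \<mu>_nonzero: "\<mu> i \<noteq> 0"
    and D_eq: "D i x = (if i \<in> S then 1 else x i + \<beta> i) / \<mu> i"
begin

text \<open>
  By its explicit form, the polynomial of \<open>\<partial>/\<partial>t\<^sub>i\<close> involves no variable except \<open>x\<^sub>i\<close>.  This is what
  makes the remaining difference equations easy to solve.
\<close>

lemma D_upd: "j \<noteq> i \<Longrightarrow> D i (x(j := z)) = D i x"
  by (simp add: D_eq)

lemma T_off_S:
  assumes "i \<notin> S"
  shows "j \<noteq> i \<Longrightarrow> T i j x = \<mu> i * x j" "T i i x = \<mu> i * (x i - \<beta> i)"
  using T_linear[of "\<lambda>_. \<beta> i" i "\<mu> i"] assms by (auto simp: D_eq \<mu>_nonzero polyfun.const)

lemma mult_D_eq_0:
  assumes "polyfun f" "\<And>x. f x * D i x = 0"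
  shows "f x = 0"
proof (rule polyfun_mult_eq_0[OF assms(1) polyfun_D[of i] assms(2)])
  show "D i (\<lambda>_. 1 - \<beta> i) \<noteq> 0" by (simp add: D_eq \<mu>_nonzero)
qed

lemma mult_D_shifted_eq_0:
  assumes "polyfun f" "\<And>x. f x * D i (x(i := x i + 1)) = 0"
  shows "f x = 0"
proof (rule polyfun_mult_eq_0[OF assms(1) polyfun_upd[OF polyfun_D] assms(2)])
  show "D i ((\<lambda>_. - \<beta> i)(i := (\<lambda>_. - \<beta> i) i + 1)) \<noteq> 0" by (simp add: D_eq \<mu>_nonzero)
qed

lemma T_upd_other:
  assumes "k \<noteq> i" "k \<noteq> j"
  shows "T i j (x(k := z)) = T i j x"
proof (rule polyfun_periodic_indep[OF polyfun_T])
  fix x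
  have "T i j (x(k := x k + 1)) - T i j x = 0"
  proof (rule mult_D_eq_0[where f = "\<lambda>x. T i j (x(k := x k + 1)) - T i j x" and i = k])
    show "polyfun (\<lambda>x. T i j (x(k := x k + 1)) - T i j x)"
      by (intro polyfun_diff polyfun_upd polyfun_T)
    show "(T i j (x(k := x k + 1)) - T i j x) * D k x = 0" for x
      using bracket_D_T_other[OF assms, of x] assms by (simp add: D_upd algebra_simps)
  qed
  then show "T i j (x(k := x k + 1)) = T i j x" by simp
qed

lemma T_diag_on_S:
  assumes "i \<in> S"
  shows "\<exists>c. \<forall>x. T i i x = \<mu> i * (x i * x i - x i + c)"
proof -
  define c where "c x = T i i x * inverse (\<mu> i) - (x i * x i - x i)" for x
  have c: "polyfun c" unfolding c_def
    by (intro polyfun_diff polyfun.mult polyfun.const polyfun.coord polyfun_T)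
  have "c (x(i := x i + 1)) = c x" for x
    using bracket_D_T_diag[of i x] \<mu>_nonzero[of i] assms
    by (simp add: c_def D_eq field_simps)
  then have 1: "c (x(i := z)) = c x" for x z by (rule polyfun_periodic_indep[OF c])
  have 2: "c (x(k := z)) = c x" if "k \<noteq> i" for k x z
    using that by (simp add: c_def T_upd_other)
  have c_const: "c x = c (\<lambda>_. 0)" for x
  proof (rule indep_all_const[where f = c])
    show "c (x(k := z)) = c x" for k x z using 1 2 by (cases "k = i") auto
  qed
  have "T i i x = \<mu> i * (x i * x i - x i + c (\<lambda>_. 0))" for x
    using c_const[of x] c_def[of x] \<mu>_nonzero[of i] by (simp add: field_simps)
  then show ?thesis by blast
qed

lemma T_diag_upd:
  assumes "k \<noteq> i"
  shows "T i i (x(k := z)) = T i i x"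
  using T_upd_other[OF assms assms] .

text \<open>
  Bracketing with \<open>\<partial>/\<partial>t\<^sub>i\<close> gives the form \<open>\<mu>\<^sub>i (x\<^sub>i x\<^sub>j + c)\<close> with \<open>c\<close> free of \<open>x\<^sub>i\<close>; bracketing with
  \<open>\<partial>/\<partial>t\<^sub>k\<close> for the other \<open>k\<close> leaves only \<open>x\<^sub>j\<close>; and since \<open>\<partial>/\<partial>t\<^sub>j\<close> commutes with
  \<open>[\<partial>/\<partial>t\<^sub>j, t\<^sub>i \<partial>\<^sub>j] = t\<^sub>i \<partial>/\<partial>t\<^sub>j\<close>, the second difference of \<open>c\<close> in \<open>x\<^sub>j\<close> is \<open>0\<close>, that is, \<open>c\<close> is affine.
\<close>

lemma T_on_S_affine:
  assumes "i \<in> S" "i \<noteq> j"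
  shows "\<exists>\<alpha> c. \<forall>x. T i j x = \<mu> i * ((x i + \<alpha>) * x j + c)"
proof -
  define c where "c x = T i j x * inverse (\<mu> i) - x i * x j" for x
  have c: "polyfun c" unfolding c_def
    by (intro polyfun_diff polyfun.mult polyfun.const polyfun.coord polyfun_T)
  have "c (x(i := x i + 1)) = c x" for x
    using bracket_D_T_same[OF assms(2), of x] \<mu>_nonzero[of i] assms
    by (simp add: c_def D_eq field_simps)
  then have c_i: "c (x(i := z)) = c x" for x z by (rule polyfun_periodic_indep[OF c])
  have c_k: "c (x(k := z)) = c x" if "k \<noteq> j" for k x z
    using that assms c_i by (cases "k = i") (auto simp: c_def T_upd_other)
  define d where "d x = c (x(j := x j + 1)) - c x" for x
  have d: "polyfun d" unfolding d_def by (intro polyfun_diff polyfun_upd c)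
  have N_d: "N i j x = \<mu> i * (x i + d x) * D j x" for x
    using bracket_D_T_N[OF assms(2), of x] \<mu>_nonzero[of i] assms
    by (simp add: D_upd d_def c_def field_simps)
  have dd: "polyfun (\<lambda>x. d (x(j := x j + 1)) - d x)" by (rule polyfun_diff[OF polyfun_upd[OF d] d])
  have "(d (x(j := x j + 1)) - d x) * D j (x(j := x j + 1)) * D j x = 0" for x
    using bracket_D_N[OF assms(2), of x] \<mu>_nonzero[of i] assms
    by (simp add: N_d D_upd fun_upd_twist[of i j]) (auto simp: algebra_simps)
  then have "(d (x(j := x j + 1)) - d x) * D j (x(j := x j + 1)) = 0" for x
    by (rule mult_D_eq_0[where i = j and f = "\<lambda>x. (d (x(j := x j + 1)) - d x) * D j (x(j := x j + 1))",
          OF polyfun.mult[OF dd polyfun_upd[OF polyfun_D, where i = j and c = 1]]])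
  then have "d (x(j := x j + 1)) - d x = 0" for x
    by (rule mult_D_shifted_eq_0[where i = j and f = "\<lambda>x. d (x(j := x j + 1)) - d x", OF dd])
  then have "d (x(j := x j + 1)) = d x" for x
    by (rule iffD1[OF right_minus_eq])
  then have d_j: "d (x(j := z)) = d x" for x z
    by (rule polyfun_periodic_indep[OF d])
  have d_k: "d (x(k := z)) = d x" if "k \<noteq> j" for k x z
    using that by (simp add: d_def fun_upd_twist[of k j] c_k)
  have d_const: "d x = d (\<lambda>_. 0)" for x
  proof (rule indep_all_const[where f = d])
    show "d (x(k := z)) = d x" for k x z using d_j d_k by (cases "k = j") auto
  qed
  define \<alpha> where "\<alpha> = d (\<lambda>_. 0)"
  define e where "e x = c x - \<alpha> * x j" for x
  have e: "polyfun e" unfolding e_def by (intro polyfun_diff polyfun.mult polyfun.const polyfun.coord c)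
  have "e (x(j := x j + 1)) = e x" for x
    using d_const[of x] by (simp add: e_def \<alpha>_def[symmetric] d_def algebra_simps)
  then have e_j: "e (x(j := z)) = e x" for x z by (rule polyfun_periodic_indep[OF e])
  have e_k: "e (x(k := z)) = e x" if "k \<noteq> j" for k x z
    using that by (simp add: e_def c_k)
  have e_const: "e x = e (\<lambda>_. 0)" for x
  proof (rule indep_all_const[where f = e])
    show "e (x(k := z)) = e x" for k x z using e_j e_k by (cases "k = j") auto
  qed
  have "T i j x = \<mu> i * ((x i + \<alpha>) * x j + e (\<lambda>_. 0))" for x
    using e_const[of x] c_def[of x] e_def[of x] \<mu>_nonzero[of i] by (simp add: field_simps)
  then show ?thesis by blast
qed

text \<open>
  The constant term of \<open>T_on_S_affine\<close> vanishes by \<open>[t\<^sub>i \<partial>/\<partial>t\<^sub>j, t\<^sub>j \<partial>\<^sub>j] = 2 t\<^sub>i \<partial>\<^sub>j\<close>, and the constant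
  of \<open>T_diag_on_S\<close> is found by computing \<open>t\<^sub>i\<^sup>2 \<partial>/\<partial>t\<^sub>j\<close> in two ways.
\<close>

lemma T_on_S:
  assumes "i \<in> S" "i \<noteq> j"
  shows "\<exists>\<alpha>. \<forall>x. T i j x = \<mu> i * (x i + \<alpha>) * x j \<and> N i j x = \<mu> i * (x i + \<alpha>) * D j x \<and>
    T i i x = \<mu> i * (x i + \<alpha>) * (x i - (\<alpha> + 1))"
proof -
  obtain \<alpha> c where T: "\<And>x. T i j x = \<mu> i * ((x i + \<alpha>) * x j + c)"
    using T_on_S_affine[OF assms] by blast
  obtain e where T_ii: "\<And>x. T i i x = \<mu> i * (x i * x i - x i + e)"
    using T_diag_on_S[OF assms(1)] by blast
  have N: "N i j x = \<mu> i * (x i + \<alpha>) * D j x" for x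
    using bracket_D_T_N[OF assms(2), of x] assms by (simp add: D_upd T algebra_simps)
  have c: "c = 0"
  proof -
    \<comment> \<open>A point where \<open>x\<^sub>i + \<alpha> = 1\<close>.\<close>
    define x :: "'n \<Rightarrow> complex" where "x = (\<lambda>_. 1 - \<alpha>)"
    have "T j j (x(i := x i - 1, j := x j + 1)) = T j j (x(j := x j + 1))"
      using assms(2) by (simp add: fun_upd_twist[of i j] T_diag_upd)
    then have "\<mu> i * (x i + \<alpha>) * (T j j (x(j := x j + 1)) * D j x - D j (x(j := x j - 1)) * T j j x) = 2 * T i j x"
      using bracket_N_T[OF assms(2), of x] assms(2) by (simp add: N algebra_simps)
    then have "\<mu> i * (2 * x j) = 2 * T i j x" by (simp only: bracket_D_T_diag) (simp add: x_def)
    then have "\<mu> i * c = 0" unfolding T by (simp add: x_def algebra_simps)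
    then show ?thesis using \<mu>_nonzero[of i] by simp
  qed
  have e: "e = - \<alpha> * (\<alpha> + 1)"
  proof -
    \<comment> \<open>A point where the polynomial of \<open>\<partial>/\<partial>t\<^sub>j\<close> does not vanish.\<close>
    define x :: "'n \<Rightarrow> complex" where "x = (\<lambda>_. 1 - \<beta> j)"
    have D0: "D j x \<noteq> 0" by (simp add: x_def D_eq \<mu>_nonzero)
    have "\<mu> i * \<mu> i * D j x * (e + \<alpha> * (\<alpha> + 1)) =
        \<mu> i * \<mu> i * D j x * e + \<mu> i * \<mu> i * D j x * \<alpha> + \<mu> i * \<mu> i * D j x * \<alpha> * \<alpha>"
      by (simp add: algebra_simps)
    also have "\<dots> = 0"
      using bracket_T_N_T[OF assms(2), of x] assms(2)
      unfolding N T T_ii \<open>c = 0\<close> by (simp add: D_upd) (simp add: algebra_simps)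
    finally have "e + \<alpha> * (\<alpha> + 1) = 0" using D0 \<mu>_nonzero[of i] by simp
    then show ?thesis by (simp add: add_eq_0_iff2)
  qed
  have "T i j x = \<mu> i * (x i + \<alpha>) * x j" "T i i x = \<mu> i * (x i + \<alpha>) * (x i - (\<alpha> + 1))" for x
    unfolding T T_ii c e by (simp_all add: algebra_simps)
  then show ?thesis using N by blast
qed

lemma N_off_S:
  assumes "i \<notin> S" "i \<noteq> j"
  shows "N i j x = \<mu> i * D j x"
  using bracket_D_T_N[OF assms(2), of x] assms by (simp add: D_upd T_off_S algebra_simps)

text \<open>
  So far there is a constant \<open>\<beta>\<^sub>i\<close> for each \<open>i \<notin> S\<close> and a constant \<open>\<alpha>\<^sub>i\<^sub>j\<close> for each \<open>i \<in> S\<close>, \<open>j \<noteq> i\<close>.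
  The relation \<open>[t\<^sub>j \<partial>/\<partial>t\<^sub>i, t\<^sub>i \<partial>/\<partial>t\<^sub>j] = \<partial>\<^sub>j - \<partial>\<^sub>i\<close> links the constants at \<open>i\<close> and \<open>j\<close>, and
  \<open>[t\<^sub>i \<partial>/\<partial>t\<^sub>j, t\<^sub>j \<partial>/\<partial>t\<^sub>k] = t\<^sub>i \<partial>/\<partial>t\<^sub>k\<close> shows \<open>\<alpha>\<^sub>i\<^sub>j = \<alpha>\<^sub>i\<^sub>k\<close> for \<open>j \<in> S\<close>.  Hence all \<open>\<alpha>\<^sub>i\<^sub>j\<close> and all
  \<open>\<beta>\<^sub>i - 1\<close> have the same value \<open>a\<close>.
\<close>

theorem generators_determined:
  assumes "CARD('n) > 1"
  shows "\<exists>a. \<forall>i. (\<forall>x. D i x = (if i \<in> S then 1 else x i + (a + 1)) / \<mu> i) \<and>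
    (\<forall>j x. T i j x = \<mu> i * (if i \<in> S then x i + a else 1) * (x j - of_bool (i = j) * (a + 1)))"
proof -
  have "\<forall>i j. \<exists>\<alpha>. i \<in> S \<longrightarrow> i \<noteq> j \<longrightarrow> (\<forall>x. T i j x = \<mu> i * (x i + \<alpha>) * x j \<and>
      N i j x = \<mu> i * (x i + \<alpha>) * D j x \<and> T i i x = \<mu> i * (x i + \<alpha>) * (x i - (\<alpha> + 1)))"
    using T_on_S by blast
  then obtain \<alpha> where \<alpha>: "\<And>i j x. i \<in> S \<Longrightarrow> i \<noteq> j \<Longrightarrow> T i j x = \<mu> i * (x i + \<alpha> i j) * x j"
      "\<And>i j x. i \<in> S \<Longrightarrow> i \<noteq> j \<Longrightarrow> N i j x = \<mu> i * (x i + \<alpha> i j) * D j x"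
      "\<And>i j x. i \<in> S \<Longrightarrow> i \<noteq> j \<Longrightarrow> T i i x = \<mu> i * (x i + \<alpha> i j) * (x i - (\<alpha> i j + 1))"
    by metis
  have \<beta>_eq: "\<beta> i = \<beta> j" if "i \<notin> S" "j \<notin> S" "i \<noteq> j" for i j
    using bracket_N_N_opposite[OF that(3), of "\<lambda>_. 0"] that \<mu>_nonzero
    by (simp add: N_off_S D_eq field_simps)
  have \<alpha>_\<beta>: "\<alpha> i j = \<beta> j - 1" if "i \<in> S" "j \<notin> S" for i j
  proof -
    have "i \<noteq> j" using that by auto
    then have "\<mu> i * \<mu> j * (\<beta> j - (1 + \<alpha> i j)) = 0"
      using bracket_N_N_opposite[of i j "\<lambda>_. 0"] that \<mu>_nonzero
      by (simp add: N_off_S D_eq \<alpha>(2) field_simps)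
    then show ?thesis using \<mu>_nonzero by simp
  qed
  have \<alpha>_sym: "\<alpha> i j = \<alpha> j i" if "i \<in> S" "j \<in> S" "i \<noteq> j" for i j
    using bracket_N_N_opposite[OF that(3), of "\<lambda>_. 0"] that \<mu>_nonzero
    by (simp add: D_eq \<alpha>(2) field_simps)
  have \<alpha>_row: "\<alpha> i j = \<alpha> i k" if "i \<in> S" "j \<in> S" "i \<noteq> j" "j \<noteq> k" "i \<noteq> k" for i j k
    using bracket_N_N_compose[OF that(3-5), of "\<lambda>_. 1 - \<beta> k"] that \<mu>_nonzero
    by (simp add: D_eq \<alpha>(2) D_upd field_simps split: if_splits)
  obtain a where a: "\<And>i. i \<notin> S \<Longrightarrow> \<beta> i = a + 1" "\<And>i j. i \<in> S \<Longrightarrow> i \<noteq> j \<Longrightarrow> \<alpha> i j = a"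
  proof (cases "S = UNIV")
    case False
    then obtain k where k: "k \<notin> S" by blast
    show ?thesis
    proof
      show "\<beta> i = \<beta> k - 1 + 1" if "i \<notin> S" for i using \<beta>_eq[of i k] that k by (cases "i = k") auto
      show "\<alpha> i j = \<beta> k - 1" if "i \<in> S" "i \<noteq> j" for i j
        using \<alpha>_row[of i j k] \<alpha>_\<beta>[of i] \<beta>_eq[of j k] that k by (cases "j \<in> S"; cases "j = k") auto
    qed
  next
    case True
    obtain i0 :: 'n where True by blast
    have row: "\<alpha> i j = \<alpha> i k" if "i \<noteq> j" "i \<noteq> k" for i j k
      using \<alpha>_row[of i j k] that True by (cases "j = k") auto
    obtain j0 where "i0 \<noteq> j0" using ex_other_index[OF assms] .
    have "\<alpha> i j = \<alpha> i0 j0" if "i \<noteq> j" for i j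
    proof (cases "i = i0")
      case True
      then show ?thesis using row[of i j j0] that \<open>i0 \<noteq> j0\<close> by simp
    next
      case False
      then show ?thesis using row[of i j i0] row[of i0 i j0] \<alpha>_sym[of i i0] that \<open>i0 \<noteq> j0\<close> \<open>S = UNIV\<close> by simp
    qed
    then show ?thesis using that True by auto
  qed
  have "D i x = (if i \<in> S then 1 else x i + (a + 1)) / \<mu> i" for i x
    using a(1)[of i] by (simp add: D_eq)
  moreover have "T i j x = \<mu> i * (if i \<in> S then x i + a else 1) * (x j - of_bool (i = j) * (a + 1))" for i j x
  proof (cases "i = j")
    case True
    obtain k where "i \<noteq> k" using ex_other_index[OF assms] .
    then show ?thesis using True a(1)[of i] a(2)[of i k] \<alpha>(3)[of i k x] T_off_S(2)[of i x] by auto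
  next
    case False
    then show ?thesis using a(2)[of i j] \<alpha>(1)[of i j x] T_off_S(1)[of i j x] by auto
  qed
  ultimately show ?thesis by blast
qed

end

section \<open>From the generators to all basis elements\<close>

lemma not_nonpos_Int: "Im z \<noteq> 0 \<Longrightarrow> z \<notin> \<int>\<^sub>\<le>\<^sub>0"
  by (auto elim!: nonpos_Ints_cases)

lemma Gamma_falling:
  fixes z :: complex
  assumes "Im z \<noteq> 0"
  shows "Gamma (z + 1) = (\<Prod>p<m. z - of_nat p) * Gamma (z + 1 - of_nat m)"
proof (induction m)
  case (Suc m)
  have "Gamma (z + 1 - of_nat m) = (z - of_nat m) * Gamma (z + 1 - of_nat (Suc m))"
    using Gamma_plus1[of "z - of_nat m"] not_nonpos_Int[of "z - of_nat m"] assms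
    by (simp add: algebra_simps)
  then show ?case using Suc by simp
qed simp

text \<open>
  The falling factorial, extended to \<open>m = -1\<close> so that \<open>falling m z = \<Gamma>(z + 1) / \<Gamma>(z + 1 - m)\<close> persists.
\<close>

definition falling :: "int \<Rightarrow> complex \<Rightarrow> complex" where
  "falling m z = (if m = - 1 then 1 / (z + 1) else \<Prod>p<nat m. z - of_nat p)"

lemma Gamma_shift:
  assumes "Im z \<noteq> 0" "m \<ge> - 1"
  shows "Gamma (z + 1) = falling m z * Gamma (z + 1 - of_int m)"
proof (cases "m = - 1")
  case True
  have "z + 1 \<noteq> 0" using assms(1) by (auto simp: complex_eq_iff)
  then show ?thesis using Gamma_plus1[of "z + 1"] not_nonpos_Int[of "z + 1"] assms True
    by (simp add: falling_def)
next
  case False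
  then have "int (nat m) = m" using assms by simp
  then have "of_int m = (of_nat (nat m) :: complex)" by (metis of_int_of_nat_eq)
  then show ?thesis using Gamma_falling[OF assms(1), of "nat m"] False by (simp add: falling_def)
qed

locale generated_shift_system = shift_system F
  for F :: "('n::finite \<Rightarrow> int) \<Rightarrow> 'n \<Rightarrow> ('n \<Rightarrow> complex) \<Rightarrow> complex" +
  fixes \<mu> :: "'n \<Rightarrow> complex" and S :: "'n set" and a :: complex
  assumes \<mu>_nonzero: "\<mu> i \<noteq> 0"
    and D_generic: "D i x = (if i \<in> S then 1 else x i + (a + 1)) / \<mu> i"
    and T_generic: "T i j x = \<mu> i * (if i \<in> S then x i + a else 1) * (x j - of_bool (i = j) * (a + 1))"
    and two_indices: "CARD('n) > 1"
begin

text \<open>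
  The quotient \<open>\<theta>(x) / \<theta>(x - k)\<close> is \<open>\<mu>\<^sup>k\<close> times the falling factorials in the action of \<open>t\<^sup>k \<partial>\<^sub>i\<close> on
  \<open>\<Omega>(\<mu>, a, S)\<close>, so rescaling by \<open>\<theta>\<close> removes both.
\<close>

definition \<theta> :: "('n \<Rightarrow> complex) \<Rightarrow> complex" where
  "\<theta> x = (\<Prod>j\<in>UNIV. \<mu> j powr x j) * (\<Prod>q\<in>S. Gamma (x q + a + 1))"

text \<open>
  A set of points that is closed under integer shifts, avoids the poles of \<open>\<theta>\<close>, and is large enough
  to determine a polynomial.
\<close>

definition generic :: "('n \<Rightarrow> complex) \<Rightarrow> bool" where
  "generic x \<longleftrightarrow> (\<forall>q. Im (x q + a) \<noteq> 0)"

abbreviation shift :: "('n \<Rightarrow> int) \<Rightarrow> ('n \<Rightarrow> complex) \<Rightarrow> 'n \<Rightarrow> complex" where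
  "shift k x \<equiv> (\<lambda>l. x l - of_int (k l))"

lemma generic_shift: "generic x \<Longrightarrow> generic (shift k x)"
  by (simp add: generic_def)

lemma theta_nonzero: "generic x \<Longrightarrow> \<theta> x \<noteq> 0"
  using not_nonpos_Int[of "x _ + a + 1"]
  by (auto simp: \<theta>_def \<mu>_nonzero Gamma_eq_zero_iff generic_def)

lemma theta_shift:
  assumes "generic x" "\<And>q. k q \<ge> - 1"
  shows "\<theta> x = (\<Prod>j\<in>UNIV. \<mu> j powi k j) * (\<Prod>q\<in>S. falling (k q) (x q + a)) * \<theta> (shift k x)"
proof -
  have "\<mu> j powr x j = \<mu> j powi k j * \<mu> j powr (x j - of_int (k j))" for j
    using \<mu>_nonzero[of j] by (simp add: powr_diff complex_powr_of_int)
  then have "(\<Prod>j\<in>UNIV. \<mu> j powr x j) = (\<Prod>j\<in>UNIV. \<mu> j powi k j) * (\<Prod>j\<in>UNIV. \<mu> j powr (x j - of_int (k j)))"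
    by (simp add: prod.distrib[symmetric])
  moreover have "(\<Prod>q\<in>S. Gamma (x q + a + 1)) =
      (\<Prod>q\<in>S. falling (k q) (x q + a)) * (\<Prod>q\<in>S. Gamma (x q - of_int (k q) + a + 1))"
  proof -
    have "Gamma (x q + a + 1) = falling (k q) (x q + a) * Gamma (x q - of_int (k q) + a + 1)" for q
      using Gamma_shift[of "x q + a" "k q"] assms by (simp add: generic_def algebra_simps)
    then show ?thesis by (simp add: prod.distrib[symmetric])
  qed
  ultimately show ?thesis by (simp add: \<theta>_def)
qed

text \<open>
  Substituting \<open>p = \<theta> f\<close> turns \<open>p \<mapsto> p(x - k) F\<^sub>k\<^sub>,\<^sub>i\<close> into \<open>f \<mapsto> (x\<^sub>i - k\<^sub>i (a + 1)) f(x - k)\<close>.  For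
  \<open>k \<in> Zplus i\<close> this says that it acts as on \<open>\<Omega>(\<mu>, a, S)\<close>.
\<close>

definition untwisted :: "('n \<Rightarrow> int) \<Rightarrow> 'n \<Rightarrow> bool" where
  "untwisted k i \<longleftrightarrow> (\<forall>x. generic x \<longrightarrow> F k i x * \<theta> (shift k x) = (x i - of_int (k i) * (a + 1)) * \<theta> x)"

text \<open>
  The operators \<open>f(x) \<mapsto> (x\<^sub>i - k\<^sub>i (a + 1)) f(x - k)\<close> obey the commutation relations.
\<close>

lemma untwisted_bracket:
  assumes "r \<in> Zplus i" "s \<in> Zplus j" "untwisted r i" "untwisted s j" "generic x"
  shows "(of_int (s i) * F (\<lambda>l. r l + s l) j x - of_int (r j) * F (\<lambda>l. r l + s l) i x) * \<theta> (shift (\<lambda>l. r l + s l) x) =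
    (of_int (s i) * (x j - of_int (r j + s j) * (a + 1)) - of_int (r j) * (x i - of_int (r i + s i) * (a + 1))) * \<theta> x"
proof -
  have rs: "shift s (shift r x) = shift (\<lambda>l. r l + s l) x" "shift r (shift s x) = shift (\<lambda>l. s l + r l) x"
    by (auto simp: algebra_simps)
  have step: "F s j (shift r x) * F r i x * \<theta> (shift (\<lambda>l. r l + s l) x) =
      (x j - of_int (r j) - of_int (s j) * (a + 1)) * (x i - of_int (r i) * (a + 1)) * \<theta> x"
    if "untwisted r i" "untwisted s j" "shift s (shift r x) = shift (\<lambda>l. r l + s l) x" for r s i j
  proof -
    have 1: "F s j (shift r x) * \<theta> (shift (\<lambda>l. r l + s l) x) = (x j - of_int (r j) - of_int (s j) * (a + 1)) * \<theta> (shift r x)"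
      if "shift s (shift r x) = shift (\<lambda>l. r l + s l) x"
      using \<open>untwisted s j\<close> generic_shift[OF assms(5), of r] unfolding untwisted_def that[symmetric] by simp
    have 2: "F r i x * \<theta> (shift r x) = (x i - of_int (r i) * (a + 1)) * \<theta> x"
      using that(1) assms(5) by (simp add: untwisted_def)
    have "F s j (shift r x) * F r i x * \<theta> t = (F s j (shift r x) * \<theta> t) * F r i x" for t by simp
    also note 1[OF that(3)]
    also have "(x j - of_int (r j) - of_int (s j) * (a + 1)) * \<theta> (shift r x) * F r i x =
        (x j - of_int (r j) - of_int (s j) * (a + 1)) * (F r i x * \<theta> (shift r x))" by simp
    also note 2
    finally show ?thesis by (simp only: mult.assoc)
  qed
  have sr: "shift (\<lambda>l. s l + r l) x = shift (\<lambda>l. r l + s l) x" by (simp add: add.commute)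
  have "(of_int (s i) * F (\<lambda>l. r l + s l) j x - of_int (r j) * F (\<lambda>l. r l + s l) i x) * \<theta> (shift (\<lambda>l. r l + s l) x) =
     F s j (shift r x) * F r i x * \<theta> (shift (\<lambda>l. r l + s l) x) - F r i (shift s x) * F s j x * \<theta> (shift (\<lambda>l. s l + r l) x)"
    unfolding bracket[OF assms(1,2), of x, symmetric] sr by (simp only: left_diff_distrib)
  also have "\<dots> = (x j - of_int (r j) - of_int (s j) * (a + 1)) * (x i - of_int (r i) * (a + 1)) * \<theta> x -
     (x i - of_int (s i) - of_int (r i) * (a + 1)) * (x j - of_int (s j) * (a + 1)) * \<theta> x"
    unfolding step[OF assms(3,4) rs(1)] step[OF assms(4,3) rs(2)] ..
  also have "\<dots> = (of_int (s i) * (x j - of_int (r j + s j) * (a + 1)) - of_int (r j) * (x i - of_int (r i + s i) * (a + 1))) * \<theta> x"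
    by (simp add: algebra_simps)
  finally show ?thesis .
qed

lemma untwisted_via_bracket:
  assumes "r \<in> Zplus i" "s \<in> Zplus j" "untwisted r i" "untwisted s j" "s i \<noteq> 0" "r j = 0 \<or> untwisted k i"
    and k: "\<And>l. k l = r l + s l"
  shows "untwisted k j"
  unfolding untwisted_def
proof (intro allI impI)
  fix x assume x: "generic x"
  have rs: "(\<lambda>l. r l + s l) = k" using k by (simp add: fun_eq_iff)
  have eq: "(of_int (s i) * F k j x - of_int (r j) * F k i x) * \<theta> (shift k x) =
    (of_int (s i) * (x j - of_int (k j) * (a + 1)) - of_int (r j) * (x i - of_int (k i) * (a + 1))) * \<theta> x"
    using untwisted_bracket[OF assms(1-4) x] unfolding rs k[symmetric] .
  moreover have "of_int (r j) * (F k i x * \<theta> (shift k x)) = of_int (r j) * ((x i - of_int (k i) * (a + 1)) * \<theta> x)"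
    using assms(6) x by (auto simp: untwisted_def)
  ultimately have "of_int (s i) * (F k j x * \<theta> (shift k x)) = of_int (s i) * ((x j - of_int (k j) * (a + 1)) * \<theta> x)"
    by (simp add: left_diff_distrib mult.assoc)
  then show "F k j x * \<theta> (shift k x) = (x j - of_int (k j) * (a + 1)) * \<theta> x"
    using assms(5) by simp
qed

lemma untwisted_zero: "untwisted (\<lambda>_. 0) i"
  by (simp add: untwisted_def F_zero)

lemma untwisted_D: "untwisted (\<lambda>l. - of_bool (l = i)) i"
proof -
  have "F (\<lambda>l. - of_bool (l = i)) i x * \<theta> (shift (\<lambda>l. - of_bool (l = i)) x) = (x i + (a + 1)) * \<theta> x"
    if "generic x" for x
  proof -
    let ?k = "\<lambda>l. - of_bool (l = i) :: int"
    have 1: "(\<Prod>j\<in>UNIV. \<mu> j powi ?k j) = inverse (\<mu> i)"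
      by (subst prod.remove[of _ i]) (auto intro!: prod.neutral)
    have 2: "(\<Prod>q\<in>S. falling (?k q) (x q + a)) = (if i \<in> S then 1 / (x i + a + 1) else 1)"
    proof -
      have "falling (?k q) (x q + a) = (if q = i then 1 / (x i + a + 1) else 1)" for q
        by (simp add: falling_def)
      then show ?thesis by simp
    qed
    define w where "w = x i + a + 1"
    have w: "w \<noteq> 0" using that by (auto simp: w_def generic_def complex_eq_iff add_eq_0_iff)
    have "\<theta> x = inverse (\<mu> i) * (if i \<in> S then 1 / w else 1) * \<theta> (shift ?k x)"
      using theta_shift[OF that, of ?k] unfolding 1 2 w_def by simp
    moreover have "F ?k i x = (if i \<in> S then 1 else w) / \<mu> i"
      using D_generic[of i x] by (simp add: D_def w_def add.assoc)
    ultimately have "F ?k i x * \<theta> (shift ?k x) = w * \<theta> x"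
      using \<mu>_nonzero[of i] w by (cases "i \<in> S") (simp_all add: inverse_eq_divide)
    then show ?thesis by (simp add: w_def add.assoc)
  qed
  then show ?thesis by (simp add: untwisted_def)
qed

lemma untwisted_T: "untwisted (\<lambda>l. of_bool (l = i)) j"
proof -
  have "F (\<lambda>l. of_bool (l = i)) j x * \<theta> (shift (\<lambda>l. of_bool (l = i)) x) = (x j - of_bool (j = i) * (a + 1)) * \<theta> x"
    if "generic x" for x
  proof -
    let ?k = "\<lambda>l. of_bool (l = i) :: int"
    have 1: "(\<Prod>j\<in>UNIV. \<mu> j powi ?k j) = \<mu> i"
      by (subst prod.remove[of _ i]) (auto intro!: prod.neutral)
    have 2: "(\<Prod>q\<in>S. falling (?k q) (x q + a)) = (if i \<in> S then x i + a else 1)"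
    proof -
      have "falling (?k q) (x q + a) = (if q = i then x i + a else 1)" for q
        by (simp add: falling_def)
      then show ?thesis by simp
    qed
    have "\<theta> x = \<mu> i * (if i \<in> S then x i + a else 1) * \<theta> (shift ?k x)"
      using theta_shift[OF that, of ?k] unfolding 1 2 by simp
    then show ?thesis using T_generic[of i j x] by (auto simp: T_def)
  qed
  then show ?thesis by (simp add: untwisted_def)
qed

text \<open>
  If \<open>s\<^sub>i \<noteq> 0\<close> and \<open>j \<noteq> l\<close>, then \<open>[t\<^sub>j \<partial>\<^sub>i, t\<^sup>s \<partial>\<^sub>l] = s\<^sub>i t\<^sub>j t\<^sup>s \<partial>\<^sub>l\<close>.
\<close>

lemma untwisted_raise:
  assumes "untwisted s l" "s \<in> Zplus l" "s i \<noteq> 0" "j \<noteq> l"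
  shows "untwisted (s(j := s j + 1)) l"
proof (rule untwisted_via_bracket[where r = "\<lambda>l. of_bool (l = j)" and i = i])
  show "untwisted (\<lambda>l. of_bool (l = j)) i" by (rule untwisted_T)
qed (use assms in \<open>auto simp: Zplus_def\<close>)

lemma untwisted_raise_many:
  assumes "untwisted s l" "s \<in> Zplus l" "s i \<noteq> 0"
  shows "k l = s l \<Longrightarrow> (\<And>j. s j \<le> k j) \<Longrightarrow> untwisted k l"
proof (induction "\<Sum>j\<in>UNIV. nat (k j - s j)" arbitrary: k rule: less_induct)
  case less
  show ?case
  proof (cases "k = s")
    case False
    then obtain j where j: "k j \<noteq> s j" by auto
    then have "j \<noteq> l" "s j < k j" using less.prems by (auto simp: order_less_le)
    define k' where "k' = k(j := k j - 1)"
    have k': "k' l = s l" "\<And>j. s j \<le> k' j"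
      using less.prems \<open>s j < k j\<close> \<open>j \<noteq> l\<close> by (auto simp: k'_def)
    have "(\<Sum>j\<in>UNIV. nat (k' j - s j)) < (\<Sum>j\<in>UNIV. nat (k j - s j))"
      by (rule sum_strict_mono_ex1) (use \<open>s j < k j\<close> in \<open>auto simp: k'_def intro!: bexI[of _ j]\<close>)
    then have "untwisted k' l" using less.hyps k' by blast
    moreover have "k' \<in> Zplus l"
      using assms(2) k' by (auto simp: Zplus_def intro: order_trans)
    moreover have "k' i \<noteq> 0"
    proof (cases "i = l")
      case False
      then have "s i > 0" using assms(2,3) by (auto simp: Zplus_def order_less_le)
      then show ?thesis using k'(2)[of i] by simp
    qed (use k' assms(3) in simp)
    ultimately have "untwisted (k'(j := k' j + 1)) l" using \<open>j \<noteq> l\<close> by (rule untwisted_raise)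
    then show ?thesis by (simp add: k'_def)
  qed (use assms in simp)
qed

text \<open>
  Raising the exponents other than \<open>k\<^sub>l\<close> starts from \<open>\<partial>/\<partial>t\<^sub>l\<close> if \<open>k\<^sub>l = -1\<close>, from \<open>t\<^sub>j \<partial>\<^sub>l\<close> if
  \<open>k\<^sub>l = 0 \<noteq> k\<^sub>j\<close>, and from \<open>t\<^sub>l\<^sup>m \<partial>\<^sub>l\<close> if \<open>k\<^sub>l = m > 0\<close>.  The last element is reached through
  \<open>[t\<^sub>l\<^sup>m \<partial>/\<partial>t\<^sub>i, t\<^sub>i \<partial>\<^sub>l] = t\<^sub>l\<^sup>m \<partial>\<^sub>l - m t\<^sub>l\<^sup>m \<partial>\<^sub>i\<close> with \<open>i \<noteq> l\<close>, whose other terms belong to the first two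
  cases.
\<close>

theorem untwisted_all:
  assumes "k \<in> Zplus l"
  shows "untwisted k l"
proof -
  have low: "untwisted k l" if "k \<in> Zplus l" "k l = - 1" for k l
    by (rule untwisted_raise_many[OF untwisted_D, where i = l]) (use that in \<open>auto simp: Zplus_def\<close>)
  have zero: "untwisted k l" if k: "k \<in> Zplus l" "k l = 0" for k l
  proof (cases "\<exists>j. k j \<noteq> 0")
    case True
    then obtain j where j: "k j \<noteq> 0" by blast
    then have "j \<noteq> l" using k by auto
    have nonneg: "k m \<ge> 0" for m using k by (cases "m = l") (auto simp: Zplus_def)
    with j have "k j \<ge> 1" by (simp add: order_less_le int_one_le_iff_zero_less)
    show ?thesis
      by (rule untwisted_raise_many[OF untwisted_T[of j], where i = j]) (use k nonneg \<open>k j \<ge> 1\<close> \<open>j \<noteq> l\<close> in \<open>auto simp: Zplus_def\<close>)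
  next
    case False
    then have "k = (\<lambda>_. 0)" by auto
    then show ?thesis using untwisted_zero by simp
  qed
  consider "k l = - 1" | "k l = 0" | "k l \<ge> 1" using assms by (fastforce simp: Zplus_def)
  then show ?thesis
  proof cases
    case 3
    obtain i where i: "l \<noteq> i" using ex_other_index[OF two_indices] .
    let ?s = "\<lambda>j. if j = l then k l else 0"
    have "untwisted ?s l"
    proof (rule untwisted_via_bracket[where r = "\<lambda>j. ?s j - of_bool (j = i)" and s = "\<lambda>j. of_bool (j = i)" and i = i])
      show "untwisted (\<lambda>j. ?s j - of_bool (j = i)) i" using i 3 by (intro low) (auto simp: Zplus_def)
      show "?s l - of_bool (l = i) = 0 \<or> untwisted ?s i" using i 3 by (intro disjI2 zero) (auto simp: Zplus_def)
    qed (use i 3 in \<open>auto simp: Zplus_def untwisted_T\<close>)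
    then show ?thesis
      by (rule untwisted_raise_many[where i = l]) (use assms 3 in \<open>auto simp: Zplus_def\<close>)
  qed (use low zero assms in auto)
qed

text \<open>
  For \<open>k\<^sub>i = -1\<close> and \<open>i \<in> S\<close> the first factor is \<open>x\<^sub>i + a + 1\<close> and cancels the pole of
  \<open>falling (-1) (x\<^sub>i + a)\<close>; this accounts for the second case in the definition of \<open>\<phi>\<close>.
\<close>

lemma prod_falling_phi:
  assumes "k \<in> Zplus i" "generic x"
  shows "(x i - of_int (k i) * (a + 1)) * (\<Prod>q\<in>S. falling (k q) (x q + a)) = peval (phi S a k i) x"
proof -
  have falling: "falling (k q) (x q + a) = (\<Prod>p<nat (k q). x q + (a - of_nat p))" if "k q \<noteq> - 1" for q
    using that by (simp add: falling_def algebra_simps)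
  show ?thesis
  proof (cases "k i \<noteq> - 1 \<or> i \<notin> S")
    case True
    have "k q \<noteq> - 1" if "q \<in> S" for q
      using assms(1) True that by (cases "q = i") (auto simp: Zplus_def dest!: spec[of _ q])
    with falling have "(\<Prod>q\<in>S. falling (k q) (x q + a)) = (\<Prod>q\<in>S. \<Prod>p<nat (k q). x q + (a - of_nat p))"
      by (intro prod.cong) auto
    then show ?thesis using True by (simp add: phi_def peval_simps)
  next
    case False
    then have i: "k i = - 1" "i \<in> S" by auto
    have "k q \<noteq> - 1" if "q \<noteq> i" for q
      using assms(1) that by (auto simp: Zplus_def dest!: spec[of _ q])
    with falling have e1: "(\<Prod>q\<in>S - {i}. falling (k q) (x q + a)) = (\<Prod>q\<in>S - {i}. \<Prod>p<nat (k q). x q + (a - of_nat p))"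
      by (intro prod.cong) auto
    have e2: "(\<Prod>q\<in>S. falling (k q) (x q + a)) = 1 / (x i + a + 1) * (\<Prod>q\<in>S - {i}. falling (k q) (x q + a))"
      using i by (subst prod.remove[of S i]) (auto simp: falling_def)
    have e3: "x i + a + 1 \<noteq> 0" using assms(2) by (auto simp: generic_def complex_eq_iff add_eq_0_iff)
    have e4: "x i - of_int (k i) * (a + 1) = x i + a + 1" by (simp add: i)
    show ?thesis unfolding e4 e2 e1 using e3 i by (simp add: phi_def peval_simps)
  qed
qed

theorem F_eq_Omega:
  assumes "k \<in> Zplus i"
  shows "F k i x = peval (Const (\<Prod>j\<in>UNIV. \<mu> j powi k j) * phi S a k i) x"
proof (rule polyfun_eq_from_generic[OF polyfun_F polyfun_peval])
  fix x :: "'n \<Rightarrow> complex"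
  assume "\<forall>q. Im (x q + a) \<noteq> 0"
  then have x: "generic x" by (simp add: generic_def)
  have k: "k q \<ge> - 1" for q using assms by (cases "q = i") (auto simp: Zplus_def dest!: spec[of _ q])
  have "F k i x * \<theta> (shift k x) = (x i - of_int (k i) * (a + 1)) * \<theta> x"
    using untwisted_all[OF assms] x by (simp add: untwisted_def)
  also have "\<dots> = (\<Prod>j\<in>UNIV. \<mu> j powi k j) * ((x i - of_int (k i) * (a + 1)) * (\<Prod>q\<in>S. falling (k q) (x q + a))) * \<theta> (shift k x)"
    by (subst theta_shift[OF x, of k, OF k]) (simp add: mult_ac)
  finally show "F k i x = peval (Const (\<Prod>j\<in>UNIV. \<mu> j powi k j) * phi S a k i) x"
    using theta_nonzero[OF generic_shift[OF x], of k]
    unfolding prod_falling_phi[OF assms x] by (simp add: peval_simps)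
qed

end

theorem shift_system_is_Omega:
  fixes F :: "('n::finite \<Rightarrow> int) \<Rightarrow> 'n \<Rightarrow> ('n \<Rightarrow> complex) \<Rightarrow> complex"
  assumes "shift_system F" "CARD('n) > 1"
  shows "\<exists>\<Lambda> a S. (\<forall>i. \<Lambda> i \<noteq> 0) \<and>
    (\<forall>i. \<forall>k\<in>Zplus i. \<forall>x. F k i x = peval (Const (\<Prod>j\<in>UNIV. \<Lambda> j powi k j) * phi S a k i) x)"
proof -
  interpret shift_system F by fact
  obtain \<mu> S \<beta> where 1: "\<forall>i. \<mu> i \<noteq> 0" "\<forall>i x. D i x = (if i \<in> S then 1 else x i + \<beta> i) / \<mu> i"
    using lowering_classification[OF assms(2)] by blast
  interpret classified_shift_system F \<mu> S \<beta> by unfold_locales (use 1 in auto)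
  obtain a where a: "\<forall>i. (\<forall>x. D i x = (if i \<in> S then 1 else x i + (a + 1)) / \<mu> i) \<and>
    (\<forall>j x. T i j x = \<mu> i * (if i \<in> S then x i + a else 1) * (x j - of_bool (i = j) * (a + 1)))"
    using generators_determined[OF assms(2)] by blast
  interpret generated_shift_system F \<mu> S a by unfold_locales (use 1 a assms(2) in auto)
  show ?thesis using F_eq_Omega 1(1) by blast
qed

section \<open>Derivations\<close>

lemma mpol_ring_induct [case_names Const Var add mult]:
  fixes f :: "'n::finite mpol"
  assumes "\<And>c. P (Const c)" "\<And>i. P (Var i)" "\<And>f g. P f \<Longrightarrow> P g \<Longrightarrow> P (f + g)" "\<And>f g. P f \<Longrightarrow> P g \<Longrightarrow> P (f * g)"
  shows "P f"
proof (induction f rule: mpol_induct)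
  case (single \<alpha> c)
  have one: "P 1" using assms(1)[of 1] by (simp add: Const_def)
  have power: "P (Var i ^ m)" for i m by (induction m) (auto intro: assms one)
  have prod: "P (\<Prod>i\<in>A. Var i ^ Poly_Mapping.lookup \<alpha> i)" for A
    by (induction A rule: infinite_finite_induct) (auto intro: assms one power)
  have "Poly_Mapping.single \<alpha> c = Const c * (\<Prod>i\<in>UNIV. Var i ^ Poly_Mapping.lookup \<alpha> i)"
    by (rule peval_inject) (simp add: peval_single peval_simps)
  then show ?case using assms prod by simp
qed (rule assms)

lemma psubst_ring_hom:
  "psubst g (Const c) = Const c" "psubst g (Var i) = g i"
  "psubst g (p + q) = psubst g p + psubst g q" "psubst g (p * q) = psubst g p * psubst g q"
  by (rule peval_inject; simp add: peval_psubst peval_simps)+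

lemma Wn_iff:
  "D \<in> Wn \<longleftrightarrow> (\<forall>f g. D (f + g) = D f + D g) \<and> (\<forall>c f. D (pscale c f) = pscale c (D f)) \<and>
    (\<forall>f g. D (f * g) = D f * g + f * D g)"
  by (auto simp: Wn_def Vector_Spaces.linear_iff vector_space_pscale)

lemma Wn_add: "D \<in> Wn \<Longrightarrow> E \<in> Wn \<Longrightarrow> (\<lambda>f. D f + E f) \<in> Wn"
  and Wn_pscale: "D \<in> Wn \<Longrightarrow> (\<lambda>f. pscale c (D f)) \<in> Wn"
  and Wn_zero: "(\<lambda>f. 0) \<in> Wn"
  by (auto simp: Wn_iff pscale_def algebra_simps)

lemma Wn_sum: "(\<And>i. i \<in> A \<Longrightarrow> E i \<in> Wn) \<Longrightarrow> (\<lambda>f. \<Sum>i\<in>A. E i f) \<in> Wn"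
  by (induction A rule: infinite_finite_induct) (auto intro: Wn_add Wn_zero)

lemma pscale_diff: "pscale c (f - g) = pscale c f - pscale c g"
  by (simp add: pscale_def algebra_simps)

lemma Wn_lie_bracket: "D \<in> Wn \<Longrightarrow> E \<in> Wn \<Longrightarrow> lie_bracket D E \<in> Wn"
  unfolding Wn_iff lie_bracket_def by (auto simp: pscale_diff algebra_simps)

lemma Wn_Const: "D \<in> Wn \<Longrightarrow> D (Const c) = 0"
proof -
  assume D: "D \<in> Wn"
  then have "D (1 * 1) = D 1 * 1 + 1 * D 1" unfolding Wn_iff by blast
  then have "D 1 = 0" by simp
  moreover have "Const c = pscale c 1" by (simp add: pscale_def)
  moreover have "D (pscale c 1) = pscale c (D 1)" using D unfolding Wn_iff by blast
  ultimately show ?thesis by (simp add: pscale_def)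
qed

text \<open>
  A derivation is determined by its values on the variables, which generate the algebra.
\<close>

lemma Wn_eqI:
  fixes D :: "'n::finite mpol \<Rightarrow> 'n mpol"
  assumes "D \<in> Wn" "E \<in> Wn" "\<And>i. D (Var i) = E (Var i)"
  shows "D = E"
proof
  fix f
  show "D f = E f"
  proof (induction f rule: mpol_ring_induct)
    case (Const c)
    then show ?case using assms by (simp add: Wn_Const)
  qed (use assms in \<open>simp_all add: Wn_iff\<close>)
qed

lemma peval_monomial: "peval (monomial m) x = (\<Prod>i\<in>UNIV. x i ^ m i)"
  by (simp add: monomial_def peval_single)

lemma Wbasis_monomial:
  assumes "r \<in> Zplus i"
  shows "Wbasis r i (monomial m) = pscale (of_nat (m i)) (monomial (\<lambda>l. nat (r l + int (m l))))"
proof (cases "m i = 0")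
  case True
  then show ?thesis by (simp add: Wbasis_def monomial_def pderiv_at_single pscale_def Const_def)
next
  case False
  have "Abs_poly_mapping (\<lambda>l. nat (r l + of_bool (l = i))) + (Abs_poly_mapping m - Poly_Mapping.single i 1) =
      Abs_poly_mapping (\<lambda>l. nat (r l + int (m l)))"
  proof (rule poly_mapping_eqI)
    fix l
    have "r l \<ge> (if l = i then - 1 else 0)" using assms by (auto simp: Zplus_def)
    then show "Poly_Mapping.lookup (Abs_poly_mapping (\<lambda>l. nat (r l + of_bool (l = i))) + (Abs_poly_mapping m - Poly_Mapping.single i 1)) l =
      Poly_Mapping.lookup (Abs_poly_mapping (\<lambda>l. nat (r l + int (m l)))) l"
      using False by (auto simp: lookup_add lookup_minus lookup_single when_def split: if_splits)
  qed
  then show ?thesis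
    by (simp add: Wbasis_def monomial_def pderiv_at_single pscale_def Const_def mult_single del: single_of_nat)
qed

lemma Wbasis_Wbasis_Var:
  assumes "r \<in> Zplus i" "s \<in> Zplus j"
  shows "Wbasis r i (Wbasis s j (Var l)) =
    (if l = j then pscale (of_int (s i + of_bool (i = j))) (monomial (\<lambda>l. nat (r l + s l + of_bool (l = j)))) else 0)"
proof (cases "l = j")
  case True
  have s: "int (nat (s l + of_bool (l = j))) = s l + of_bool (l = j)" for l
    using assms(2) by (cases "l = j") (auto simp: Zplus_def)
  have "(of_nat (nat (s i + of_bool (i = j))) :: complex) = of_int (int (nat (s i + of_bool (i = j))))"
    by (simp del: int_nat_eq)
  with True s show ?thesis
    by (simp add: Wbasis_Var Wbasis_monomial[OF assms(1)] add.assoc del: of_int_add int_nat_eq)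
next
  case False
  have "Wbasis r i 0 = 0" using Wn_Const[OF Wbasis_in_Wn, of r i 0] by (simp add: Const_def)
  then show ?thesis using False by (simp add: Wbasis_Var)
qed

lemma lie_bracket_Wbasis:
  assumes "r \<in> Zplus i" "s \<in> Zplus j"
  shows "lie_bracket (Wbasis r i) (Wbasis s j) =
    (\<lambda>f. pscale (of_int (s i)) (Wbasis (\<lambda>l. r l + s l) j f) + pscale (- of_int (r j)) (Wbasis (\<lambda>l. r l + s l) i f))"
    (is "_ = ?E")
proof (rule Wn_eqI)
  show "lie_bracket (Wbasis r i) (Wbasis s j) \<in> Wn" by (intro Wn_lie_bracket Wbasis_in_Wn)
  show "?E \<in> Wn" by (intro Wn_add Wn_pscale Wbasis_in_Wn)
  show "lie_bracket (Wbasis r i) (Wbasis s j) (Var l) = ?E (Var l)" for l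
    unfolding lie_bracket_def Wbasis_Wbasis_Var[OF assms] Wbasis_Wbasis_Var[OF assms(2,1)]
      add.commute[of "s m" "r m" for m]
    by (rule peval_inject) (auto simp: Wbasis_Var peval_simps left_diff_distrib distrib_right)
qed

lemma Wn_decompose:
  fixes D :: "'n::finite mpol \<Rightarrow> 'n mpol"
  assumes "D \<in> Wn"
  shows "D = (\<lambda>f. \<Sum>i\<in>UNIV. \<Sum>m\<in>Poly_Mapping.keys (D (Var i)). pscale (Poly_Mapping.lookup (D (Var i)) m)
    (Wbasis (\<lambda>j. int (Poly_Mapping.lookup m j) - of_bool (j = i)) i f))" (is "_ = ?E")
proof (rule Wn_eqI[OF assms])
  show "?E \<in> Wn" by (intro Wn_sum Wn_pscale Wbasis_in_Wn)
  show "D (Var l) = ?E (Var l)" for l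
  proof (rule peval_inject)
    fix x
    have "peval (?E (Var l)) x = (\<Sum>i\<in>UNIV. if i = l then \<Sum>m\<in>Poly_Mapping.keys (D (Var i)).
        Poly_Mapping.lookup (D (Var i)) m * (\<Prod>j\<in>UNIV. x j ^ Poly_Mapping.lookup m j) else 0)"
      unfolding peval_sum peval_pscale Wbasis_Var
      by (intro sum.cong refl) (auto simp: peval_monomial peval_zero)
    also have "\<dots> = peval (D (Var l)) x" by (simp add: peval_def)
    finally show "peval (D (Var l)) x = peval (?E (Var l)) x" ..
  qed
qed

section \<open>From modules to families of polynomials\<close>

text \<open>
  The module axioms for the second action are not assumed: they follow by pulling back along \<open>h\<close>.
\<close>

lemma Wn_module_transport:
  fixes scale :: "complex \<Rightarrow> 'a::ab_group_add \<Rightarrow> 'a" and scale' :: "complex \<Rightarrow> 'b::ab_group_add \<Rightarrow> 'b"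
    and act :: "('n::finite mpol \<Rightarrow> 'n mpol) \<Rightarrow> 'a \<Rightarrow> 'a" and act' :: "('n mpol \<Rightarrow> 'n mpol) \<Rightarrow> 'b \<Rightarrow> 'b"
  assumes "Wn_module scale act" "vector_space scale'" "bij h"
    and add: "\<And>p q. h (p + q) = h p + h q"
    and scale: "\<And>c p. h (scale' c p) = scale c (h p)"
    and act: "\<And>D p. D \<in> Wn \<Longrightarrow> h (act' D p) = act D (h p)"
  shows "Wn_module_isomorphic scale act scale' act'"
proof -
  interpret M: Wn_module scale act by fact
  have inj: "h p = h q \<Longrightarrow> p = q" for p q using \<open>bij h\<close> by (simp add: bij_def inj_eq)
  have diff: "h (p - q) = h p - h q" for p q using add[of "p - q" q] by simp
  have "Wn_module scale' act'"
  proof (intro Wn_module.intro Wn_module_axioms.intro assms(2); rule inj)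
  qed (simp_all add: act add scale diff Wn_add Wn_pscale Wn_lie_bracket M.act_add_right M.act_scale_right
      M.act_add_left M.act_scale_left M.act_bracket)
  moreover have "Vector_Spaces.linear scale scale' (inv h)"
    unfolding Vector_Spaces.linear_iff
    using assms(2) M.vector_space_axioms bij_is_surj[OF \<open>bij h\<close>]
    by (auto intro!: inj simp: add scale surj_f_inv_f)
  moreover have "inv h (act D v) = act' D (inv h v)" if "D \<in> Wn" for D v
    using that bij_is_surj[OF \<open>bij h\<close>] by (intro inj) (simp add: act surj_f_inv_f)
  moreover have "bij (inv h)" using \<open>bij h\<close> by (rule bij_imp_bij_inv)
  ultimately show ?thesis using M.Wn_module_axioms unfolding Wn_module_isomorphic_def by blast
qed

context Wn_module begin

lemma act_zero_left: "act (\<lambda>f. 0) v = 0"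
proof -
  have "act (\<lambda>f. pscale 0 (euler i f)) v = 0" for i
    using act_scale_left[OF Wbasis_in_Wn] by simp
  then show ?thesis by (simp add: pscale_def Const_def)
qed

lemma act_sum: "(\<And>i. i \<in> A \<Longrightarrow> E i \<in> Wn) \<Longrightarrow> act (\<lambda>f. \<Sum>i\<in>A. E i f) v = (\<Sum>i\<in>A. act (E i) v)"
  by (induction A rule: infinite_finite_induct) (auto simp: act_zero_left act_add_left Wn_sum)

lemma act_bracket_Wbasis:
  assumes "r \<in> Zplus i" "s \<in> Zplus j"
  shows "act (Wbasis r i) (act (Wbasis s j) v) - act (Wbasis s j) (act (Wbasis r i) v) =
    scale (of_int (s i)) (act (Wbasis (\<lambda>l. r l + s l) j) v) - scale (of_int (r j)) (act (Wbasis (\<lambda>l. r l + s l) i) v)"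
  using act_bracket[OF Wbasis_in_Wn Wbasis_in_Wn, of r i s j v, symmetric]
  by (simp add: lie_bracket_Wbasis[OF assms] act_add_left[OF Wn_pscale[OF Wbasis_in_Wn] Wn_pscale[OF Wbasis_in_Wn]]
      act_scale_left[OF Wbasis_in_Wn])

text \<open>
  The weight relation \<open>[\<partial>\<^sub>j, t\<^sup>k \<partial>\<^sub>i] = k\<^sub>j t\<^sup>k \<partial>\<^sub>i\<close> lets \<open>t\<^sup>k \<partial>\<^sub>i\<close> pass each \<open>\<partial>\<^sub>j\<close> at the cost of replacing it
  by \<open>\<partial>\<^sub>j - k\<^sub>j\<close>.
\<close>

lemma act_Uh_scale:
  assumes "k \<in> Zplus i"
  shows "act (Wbasis k i) (Uh_scale scale act p v) =
    Uh_scale scale act (psubst (\<lambda>j. Var j - Const (of_int (k j))) p) (act (Wbasis k i) v)"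
proof (induction p arbitrary: v rule: mpol_ring_induct)
  interpret U: module "Uh_scale scale act" by (rule module_Uh_scale)
  note W = Wbasis_in_Wn[of k i]
  {
    case (Const c)
    then show ?case using W by (simp add: psubst_ring_hom Uh_scale_Const act_scale_right)
  next
    case (Var j)
    have "act (euler j) (act (Wbasis k i) v) - act (Wbasis k i) (act (euler j) v) =
        scale (of_int (k j)) (act (Wbasis k i) v)"
      using act_bracket_Wbasis[of "\<lambda>_. 0" j k i v] assms by (simp add: Zplus_def)
    then show ?case
      by (simp add: psubst_ring_hom U.scale_left_diff_distrib Uh_scale_Const Uh_scale_Var algebra_simps)
  next
    case (add f g)
    then show ?case using W by (simp add: psubst_ring_hom U.scale_left_distrib act_add_right)
  next
    case (mult f g)
    then show ?case by (simp add: psubst_ring_hom flip: U.scale_scale)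
  }
qed

lemma free_rank_1_generator:
  assumes "free_module_of_rank (Uh_scale scale act) 1"
  shows "\<exists>v. bij (\<lambda>p. Uh_scale scale act p v)"
proof -
  interpret U: module "Uh_scale scale act" by (rule module_Uh_scale)
  obtain B where B: "finite B" "card B = 1" "\<not> U.dependent B" "U.span B = UNIV"
    using assms unfolding free_module_of_rank_def by blast
  then obtain v where v: "B = {v}" by (auto simp: card_1_singleton_iff)
  have zero: "p = 0" if "Uh_scale scale act p v = 0" for p
    using U.independentD[of B B "\<lambda>_. p" v] B that by (simp add: v)
  have "inj (\<lambda>p. Uh_scale scale act p v)"
  proof (rule injI)
    fix p q assume "Uh_scale scale act p v = Uh_scale scale act q v"
    then show "p = q" using zero[of "p - q"] by (simp add: U.scale_left_diff_distrib)
  qed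
  moreover have "surj (\<lambda>p. Uh_scale scale act p v)"
    using B(4) U.span_singleton[of v] by (simp add: v)
  ultimately show ?thesis by (auto simp: bij_def)
qed

end

theorem theorem8:
  fixes scale :: "complex \<Rightarrow> 'm::ab_group_add \<Rightarrow> 'm"
    and act :: "('n::finite mpol \<Rightarrow> 'n mpol) \<Rightarrow> 'm \<Rightarrow> 'm"
  assumes "CARD('n) > 1"
    and "Wn_module scale act"
    and "free_module_of_rank (Uh_scale scale act) 1"
  shows "\<exists>(\<Lambda> :: 'n \<Rightarrow> complex) (a :: complex) (S :: 'n set).
           (\<forall>i. \<Lambda> i \<noteq> 0) \<and>
           Wn_module_isomorphic scale act pscale (Omega_act \<Lambda> a S)"
proof -
  interpret Wn_module scale act by fact
  interpret U: module "Uh_scale scale act" by (rule module_Uh_scale)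
  obtain v where bij: "bij (\<lambda>p. Uh_scale scale act p v)"
    using free_rank_1_generator[OF assms(3)] by blast
  define h where "h p = Uh_scale scale act p v" for p
  have bij_h: "bij h" using bij by (simp add: h_def[abs_def])
  have h_add: "h (p + q) = h p + h q" for p q by (simp add: h_def U.scale_left_distrib)
  have h_diff: "h (p - q) = h p - h q" for p q by (simp add: h_def U.scale_left_diff_distrib)
  have h_scale: "h (pscale c p) = scale c (h p)" for c p
    by (simp add: h_def pscale_def Uh_scale_Const flip: U.scale_scale)
  have h_inj: "p = q" if "h p = h q" for p q using that bij_h by (simp add: bij_def inj_eq)
  define F where "F k i = inv h (act (Wbasis k i) v)" for k i
  have h_F: "h (F k i) = act (Wbasis k i) v" for k i
    using bij_is_surj[OF bij_h] by (simp add: F_def surj_f_inv_f)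
  have act_h: "act (Wbasis k i) (h p) = h (psubst (\<lambda>j. Var j - Const (of_int (k j))) p * F k i)"
    if "k \<in> Zplus i" for k i p
    using act_Uh_scale[OF that, of p v] by (simp add: h_F[symmetric] h_def U.scale_scale)
  have "shift_system (\<lambda>k i. peval (F k i))"
  proof
    show "polyfun (peval (F k i))" for k i by (rule polyfun_peval)
    have "F (\<lambda>_. 0) i = Var i" for i
      by (rule h_inj) (simp only: h_F, simp add: h_def Uh_scale_Var)
    then show "peval (F (\<lambda>_. 0) i) x = x i" for i x by (simp add: peval_Var)
    fix r s :: "'n \<Rightarrow> int" and i j and x :: "'n \<Rightarrow> complex"
    assume r: "r \<in> Zplus i" and s: "s \<in> Zplus j"
    have "psubst (\<lambda>l. Var l - Const (of_int (r l))) (F s j) * F r i -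
        psubst (\<lambda>l. Var l - Const (of_int (s l))) (F r i) * F s j =
      pscale (of_int (s i)) (F (\<lambda>l. r l + s l) j) - pscale (of_int (r j)) (F (\<lambda>l. r l + s l) i)"
      using act_bracket_Wbasis[OF r s, of v]
      by (intro h_inj) (simp add: h_diff h_scale h_F act_h[OF r, symmetric] act_h[OF s, symmetric])
    from arg_cong[OF this, of "\<lambda>p. peval p x"]
    show "peval (F s j) (\<lambda>l. x l - of_int (r l)) * peval (F r i) x -
        peval (F r i) (\<lambda>l. x l - of_int (s l)) * peval (F s j) x =
      of_int (s i) * peval (F (\<lambda>l. r l + s l) j) x - of_int (r j) * peval (F (\<lambda>l. r l + s l) i) x"
      by (simp add: peval_simps peval_psubst)
  qed
  from shift_system_is_Omega[OF this assms(1)] obtain \<Lambda> a S where \<Lambda>: "\<forall>i. \<Lambda> i \<noteq> 0"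
    and F: "\<forall>i. \<forall>k\<in>Zplus i. \<forall>x. peval (F k i) x =
      peval (Const (\<Prod>j\<in>UNIV. \<Lambda> j powi k j) * phi S a k i) x" by blast
  have act_basis: "act (Wbasis k i) (h p) = h (Omega_basis_act \<Lambda> a S k i p)" if "k \<in> Zplus i" for k i p
  proof -
    have "F k i = Const (\<Prod>j\<in>UNIV. \<Lambda> j powi k j) * phi S a k i"
      using F that by (intro peval_inject) blast
    then show ?thesis by (simp add: act_h[OF that] Omega_basis_act_def mult_ac)
  qed
  have h_sum: "h (\<Sum>i\<in>A. f i) = (\<Sum>i\<in>A. h (f i))" for A and f :: "'b \<Rightarrow> 'n mpol"
    by (simp add: h_def U.scale_sum_left)
  have h_act: "h (Omega_act \<Lambda> a S D p) = act D (h p)" if D: "D \<in> Wn" for D p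
  proof -
    let ?k = "\<lambda>m i j. int (Poly_Mapping.lookup m j) - of_bool (j = i)"
    have k: "?k m i \<in> Zplus i" for m i by (auto simp: Zplus_def)
    have "act D (h p) = (\<Sum>i\<in>UNIV. \<Sum>m\<in>Poly_Mapping.keys (D (Var i)).
        scale (Poly_Mapping.lookup (D (Var i)) m) (act (Wbasis (?k m i) i) (h p)))"
      by (subst Wn_decompose[OF D])
        (simp add: act_sum Wn_sum Wn_pscale Wbasis_in_Wn act_scale_left)
    also have "\<dots> = h (Omega_act \<Lambda> a S D p)"
      by (simp add: Omega_act_def h_sum h_scale act_basis[OF k])
    finally show ?thesis ..
  qed
  have "Wn_module_isomorphic scale act pscale (Omega_act \<Lambda> a S)"
    by (rule Wn_module_transport[where h = h, OF assms(2) vector_space_pscale bij_h h_add h_scale h_act])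
  with \<Lambda> show ?thesis by blast
qed

end
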